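(* Let $\Gamma_{\mathcal{A}}$ be a topological space and let $\mathcal{A} \subset C_{b}(\Gamma_{\mathcal{A}})$ be an ACK-subalgebra. Let $Z$ be a Banach space, $\mathcal{O}\subset L(Z)$ a non-empty set and $\rho\in[0,1)$ such that $Z \in \mathcal{O}\text{-}\mathrm{ACK}_\rho$ (respectively $Z \in \mathcal{O}\text{-}\mathrm{ACK}$), with $\Gamma_Z \subset B_{Z^*}$ being the corresponding $1$-norming set. Let $\tau$ be a $\Gamma_Z$-acceptable topology on $Z$. Let $X \subset C_{b}(\Gamma_{\mathcal{A}}, (Z, \tau))$ be a Banach space (a linear subspace with the sup-norm) satisfying: (i) for every $x \in X$ and $f \in\mathcal{A}$ the function $fx$ belongs to $X$; (ii) $X$ contains all functions of the form $f\otimes z$ (i.e. $t\mapsto f(t)z$), $f \in\mathcal{A}$, $z \in Z$; (iii) $F \circ x \in X$ for every $x \in X$ and $F \in \mathcal{O}$; (iv) for every finite collection $\{x_k\}_{k=1}^n \subset X$ the function of two variables $\varphi \colon \Gamma_{\mathcal{A}} \times (\Gamma_Z, w^* ) \to \mathbb{K}^n$ defined by $\varphi (t, z^* ) = (z^*(x_k(t)))_{k=1}^n $ is quasi-continuous. Then $X \in \mathrm{ACK}_\rho$ (respectively $X \in \mathrm{ACK}$), with the corresponding $1$-norming subset of $B_{X^*}$ being $\Gamma=\{\delta_t \otimes z^*: t\in \Gamma_{\mathcal{A}}, z^* \in \Gamma_Z\}$, where the functional $\delta_t \otimes z^* \in X^*$ acts by $(\delta_t \otimes z^* )(x) = z^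*(x(t))$.
   Context: Banach spaces are over $\mathbb{K}\in\{\mathbb{R},\mathbb{C}\}$. $B_X$, $S_X$ are the closed unit ball and unit sphere; $L(X)$ is the space of bounded linear operators on $X$; $w^*$ is the weak-star topology; $\mathrm{aco}\{0,V\}$ is the absolutely convex hull of $V\cup\{0\}$. A set $\Gamma\subset B_{X^*}$ is $1$-norming if $\|x\|=\sup_{x^*\in\Gamma}|x^*(x)|$ for all $x\in X$. ACK structure. Let $X$ be a Banach space, $\mathcal{O}\subset L(X)$ non-empty and $\rho\in[0,1)$. $X\in\mathcal{O}\text{-}\mathrm{ACK}_\rho$ if there is a $1$-norming set $\Gamma\subset B_{X^*}$ (the corresponding $1$-norming set) such that for every $\varepsilon>0$ and every non-empty relatively $w^*$-open $U\subset\Gamma$ there exist a non-empty $V\subset U$, vectors $x_1^*\in V$, $e\in S_X$ and an operator $F\in\mathcal{O}$ with: (I) $\|Fe\|=\|F\|=1$; (II) $x_1^*(Fe)=1$; (III) $F^*x_1^*=x_1^*$; (IV) denoting $V_1=\{x^*\in\Gamma:\|F^*x^*\|+(1-\varepsilon)\|(I_{X^*}-F^* )(x^* )\|\le 1\}$, one has $|v^*(Fe)|\le\rho$ for every $v^*\in\Gamma\setminus V_1$; (V) $\mathrm{dist}(F^*x^*,\mathrm{aco}\{0,V\})<\varepsilon$ for every $x^*\in\Gamma$; (VI) $|v^*(e)-1|\le\varepsilon$ for every $v^*\in V$. $X\in\mathcal{O}\text{-}\mathrm{ACK}$ (simple structure) if the same holds with (IV) replaced by $V_1=\Gamma$. When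 $\mathcal{O}=L(X)$ one writes $\mathrm{ACK}_\rho$ and $\mathrm{ACK}$. For a topological space $T$, $C_b(T)$ is the space of bounded continuous functions $T\to\mathbb{K}$ with sup-norm; for a topology $\tau$ on $Z$, $C_b(T,(Z,\tau))$ is the space of (norm-)bounded $\tau$-continuous functions $T\to Z$ with sup-norm. Let $\mathrm{St}_\varepsilon=\{z\in\mathbb{C}:|z|+(1-\varepsilon)|1-z|\le1\}$. A subalgebra $\mathcal{A}\subset C_b(T)$ is an ACK-subalgebra if for every non-empty open $W\subset T$ and $0<\varepsilon<1$ there exist $f\in\mathcal{A}$ and $t_0\in W$ with $f(t_0)=\|f\|_\infty=1$, $|f(t)|<\varepsilon$ for every $t\in T\setminus W$, and $f(T)\subset\mathrm{St}_\varepsilon$. A linear topology $\tau$ on $Z$ is $\Gamma_Z$-acceptable if it is dominated by (coarser than or equal to) the norm topology and dominates $\sigma(Z,\Gamma_Z)$, the weakest topology on $Z$ making all elements of $\Gamma_Z$ continuous. A function $f\colon A\to B$ between topological spaces is quasi-continuous if for every non-empty open $U\subset A$, every $z\in U$ and every neighborhood $V$ of $f(z)$ there is a non-empty open $W\subset U$ with $f(W)\subset V$. *)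

theory Defs
  imports "HOL-Analysis.Analysis" "HOL-Library.Function_Algebras"
begin

section \<open>Scalars and Banach spaces\<close>

text \<open>The scalar field is real or complex, up to isometric isomorphism; a statement about an
  arbitrary type of this class covers both cases.\<close>

class real_or_complex = real_normed_field +
  assumes ex_isometric_embedding:
    "\<exists>h :: 'a \<Rightarrow> complex. h 1 = 1 \<and> (\<forall>a b. h (a + b) = h a + h b) \<and> (\<forall>a b. h (a * b) = h a * h b)
       \<and> (\<forall>a. cmod (h a) = norm a) \<and> range h \<in> {\<real>, UNIV}"

instance real :: real_or_complex
proof
  show "\<exists>h :: real \<Rightarrow> complex. h 1 = 1 \<and> (\<forall>a b. h (a + b) = h a + h b)
       \<and> (\<forall>a b. h (a * b) = h a * h b) \<and> (\<forall>a. cmod (h a) = norm a) \<and> range h \<in> {\<real>, UNIV}"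
    by (intro exI[of _ complex_of_real]) (auto simp: Reals_def)
qed

instance complex :: real_or_complex
proof
  show "\<exists>h :: complex \<Rightarrow> complex. h 1 = 1 \<and> (\<forall>a b. h (a + b) = h a + h b)
       \<and> (\<forall>a b. h (a * b) = h a * h b) \<and> (\<forall>a. cmod (h a) = norm a) \<and> range h \<in> {\<real>, UNIV}"
    by (intro exI[of _ id]) auto
qed

text \<open>Spaces of vector-valued functions are subsets of a function type, so a normed space is a
  subspace \<open>X\<close> of an ambient vector space together with a norm \<open>N\<close> that matters only on \<open>X\<close>.
  When \<open>X\<close> is a whole type of class \<open>banach\<close> and \<open>N\<close> its class norm, the real scaling of the class
  automatically agrees with \<open>scale\<close>: both are continuous and agree on rational scalars.\<close>

locale normed_space_on = vector_space scale
  for scale :: "'k::real_or_complex \<Rightarrow> 'v::ab_group_add \<Rightarrow> 'v" +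
  fixes X :: "'v set" and N :: "'v \<Rightarrow> real"
  assumes subspace_carrier: "subspace X"
    and norm_nonneg: "x \<in> X \<Longrightarrow> 0 \<le> N x"
    and norm_eq_zero: "x \<in> X \<Longrightarrow> N x = 0 \<longleftrightarrow> x = 0"
    and norm_triangle: "x \<in> X \<Longrightarrow> y \<in> X \<Longrightarrow> N (x + y) \<le> N x + N y"
    and norm_scale: "x \<in> X \<Longrightarrow> N (scale a x) = norm a * N x"

locale banach_space_on = normed_space_on +
  assumes complete_carrier: "Metric_space.mcomplete X (\<lambda>x y. N (x - y))"

text \<open>Bounded linear maps between the normed spaces \<open>(s, X, N)\<close> and \<open>(s', Y, M)\<close>. They are
  normalised to vanish outside \<open>X\<close>, which makes each map on \<open>X\<close> a unique object, and makes
  pointwise operations and composition of HOL functions agree with those of the maps.\<close>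

definition bounded_linear_maps ::
  "('k \<Rightarrow> 'v \<Rightarrow> 'v) \<Rightarrow> 'v set \<Rightarrow> ('v \<Rightarrow> real) \<Rightarrow> ('k \<Rightarrow> 'w \<Rightarrow> 'w) \<Rightarrow> 'w set \<Rightarrow> ('w \<Rightarrow> real)
     \<Rightarrow> ('v::ab_group_add \<Rightarrow> 'w::ab_group_add) set" where
  "bounded_linear_maps s X N s' Y M =
     {f. (\<forall>x\<in>X. f x \<in> Y) \<and> (\<forall>x. x \<notin> X \<longrightarrow> f x = 0)
       \<and> (\<forall>x\<in>X. \<forall>y\<in>X. f (x + y) = f x + f y)
       \<and> (\<forall>a. \<forall>x\<in>X. f (s a x) = s' a (f x))
       \<and> (\<exists>C. \<forall>x\<in>X. M (f x) \<le> C * N x)}"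

definition operator_norm :: "'v set \<Rightarrow> ('v \<Rightarrow> real) \<Rightarrow> ('w \<Rightarrow> real) \<Rightarrow> ('v \<Rightarrow> 'w) \<Rightarrow> real" where
  "operator_norm X N M f = (SUP x\<in>{x\<in>X. N x \<le> 1}. M (f x))"

definition bounded_operators ::
  "('k \<Rightarrow> 'v \<Rightarrow> 'v) \<Rightarrow> 'v set \<Rightarrow> ('v \<Rightarrow> real) \<Rightarrow> ('v::ab_group_add \<Rightarrow> 'v) set" where
  "bounded_operators s X N = bounded_linear_maps s X N s X N"

definition dual ::
  "('k::real_or_complex \<Rightarrow> 'v \<Rightarrow> 'v) \<Rightarrow> 'v set \<Rightarrow> ('v \<Rightarrow> real) \<Rightarrow> ('v::ab_group_add \<Rightarrow> 'k) set" where
  "dual s X N = bounded_linear_maps s X N (*) UNIV norm"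

abbreviation dual_norm :: "'v set \<Rightarrow> ('v \<Rightarrow> real) \<Rightarrow> ('v \<Rightarrow> 'k::real_or_complex) \<Rightarrow> real" where
  "dual_norm X N \<equiv> operator_norm X N norm"

definition dual_ball ::
  "('k::real_or_complex \<Rightarrow> 'v \<Rightarrow> 'v) \<Rightarrow> 'v set \<Rightarrow> ('v \<Rightarrow> real) \<Rightarrow> ('v::ab_group_add \<Rightarrow> 'k) set" where
  "dual_ball s X N = {\<phi> \<in> dual s X N. dual_norm X N \<phi> \<le> 1}"

definition adjoint_map :: "('v \<Rightarrow> 'v) \<Rightarrow> ('v \<Rightarrow> 'k) \<Rightarrow> ('v \<Rightarrow> 'k)" where
  "adjoint_map F \<phi> = \<phi> \<circ> F"

text \<open>The pointwise scalar multiplication of functions induced by \<open>s\<close>; for \<open>s = (*)\<close> that of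
  scalar-valued functions. Addition is pointwise by \<^theory>\<open>HOL-Library.Function_Algebras\<close>.\<close>

definition pointwise_scale :: "('k \<Rightarrow> 'v \<Rightarrow> 'v) \<Rightarrow> 'k \<Rightarrow> ('a \<Rightarrow> 'v) \<Rightarrow> ('a \<Rightarrow> 'v)" where
  "pointwise_scale s a f = (\<lambda>t. s a (f t))"

definition sup_norm :: "('a \<Rightarrow> 'b::real_normed_vector) \<Rightarrow> real" where
  "sup_norm f = (SUP t. norm (f t))"

section \<open>Weak topologies and norming sets\<close>

definition weakest_topology :: "'a set \<Rightarrow> ('a \<Rightarrow> 'b::topological_space) set \<Rightarrow> 'a topology" where
  "weakest_topology S \<Phi> =
     topology_generated_by (insert S {{y \<in> S. \<phi> y \<in> G} | \<phi> G. \<phi> \<in> \<Phi> \<and> open G})"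

definition weak_star ::
  "('k::real_or_complex \<Rightarrow> 'v \<Rightarrow> 'v) \<Rightarrow> 'v set \<Rightarrow> ('v \<Rightarrow> real) \<Rightarrow> ('v::ab_group_add \<Rightarrow> 'k) topology" where
  "weak_star s X N = weakest_topology (dual s X N) ((\<lambda>x \<phi>. \<phi> x) ` X)"

definition one_norming :: "'v set \<Rightarrow> ('v \<Rightarrow> real) \<Rightarrow> ('v \<Rightarrow> 'k::real_or_complex) set \<Rightarrow> bool" where
  "one_norming X N \<Gamma> \<longleftrightarrow> (\<forall>x\<in>X. N x = (SUP \<phi>\<in>\<Gamma>. norm (\<phi> x)))"

definition absolutely_convex ::
  "('k::real_or_complex \<Rightarrow> 'v \<Rightarrow> 'v) \<Rightarrow> 'v::ab_group_add set \<Rightarrow> bool" where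
  "absolutely_convex s C \<longleftrightarrow>
     (\<forall>x\<in>C. \<forall>y\<in>C. \<forall>a b. norm a + norm b \<le> 1 \<longrightarrow> s a x + s b y \<in> C)"

definition aco :: "('v \<Rightarrow> 'k::real_or_complex) set \<Rightarrow> ('v \<Rightarrow> 'k) set" where
  "aco V = absolutely_convex (pointwise_scale (*)) hull V"

definition dual_dist ::
  "'v set \<Rightarrow> ('v \<Rightarrow> real) \<Rightarrow> ('v \<Rightarrow> 'k::real_or_complex) \<Rightarrow> ('v \<Rightarrow> 'k) set \<Rightarrow> real" where
  "dual_dist X N \<phi> C = (INF \<psi>\<in>C. dual_norm X N (\<phi> - \<psi>))"

section \<open>ACK structures\<close>

definition ack_V1 ::
  "'v set \<Rightarrow> ('v \<Rightarrow> real) \<Rightarrow> ('v \<Rightarrow> 'k::real_or_complex) set \<Rightarrow> real \<Rightarrow> ('v \<Rightarrow> 'v)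
     \<Rightarrow> ('v \<Rightarrow> 'k) set" where
  "ack_V1 X N \<Gamma> \<epsilon> F = {\<phi> \<in> \<Gamma>.
     dual_norm X N (adjoint_map F \<phi>) + (1 - \<epsilon>) * dual_norm X N (\<phi> - adjoint_map F \<phi>) \<le> 1}"

text \<open>All ACK conditions except (IV), the only one in which the two notions differ.\<close>

definition ack_base ::
  "'v::ab_group_add set \<Rightarrow> ('v \<Rightarrow> real) \<Rightarrow> ('v \<Rightarrow> 'k::real_or_complex) set \<Rightarrow> real
     \<Rightarrow> ('v \<Rightarrow> 'k) set \<Rightarrow> ('v \<Rightarrow> 'k) \<Rightarrow> 'v \<Rightarrow> ('v \<Rightarrow> 'v) \<Rightarrow> bool" where
  "ack_base X N \<Gamma> \<epsilon> V \<phi>\<^sub>1 e F \<longleftrightarrow>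
     N (F e) = 1 \<and> operator_norm X N N F = 1 \<and>
     \<phi>\<^sub>1 (F e) = 1 \<and>
     adjoint_map F \<phi>\<^sub>1 = \<phi>\<^sub>1 \<and>
     (\<forall>\<phi>\<in>\<Gamma>. dual_dist X N (adjoint_map F \<phi>) (aco ({0} \<union> V)) < \<epsilon>) \<and>
     (\<forall>\<phi>\<in>V. norm (\<phi> e - 1) \<le> \<epsilon>)"

text \<open>\<open>ack_rho s X N Ops \<rho> \<Gamma>\<close>: the Banach space \<open>X\<close> belongs to the class \<open>Ops\<close>-ACK with
  parameter \<open>\<rho>\<close>, with corresponding 1-norming set \<open>\<Gamma>\<close>. Membership in the class is existence of
  such a \<open>\<Gamma>\<close>.\<close>

definition ack_rho ::
  "('k::real_or_complex \<Rightarrow> 'v \<Rightarrow> 'v) \<Rightarrow> 'v::ab_group_add set \<Rightarrow> ('v \<Rightarrow> real) \<Rightarrow> ('v \<Rightarrow> 'v) set \<Rightarrow> real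
     \<Rightarrow> ('v \<Rightarrow> 'k) set \<Rightarrow> bool" where
  "ack_rho s X N Ops \<rho> \<Gamma> \<longleftrightarrow>
     \<Gamma> \<subseteq> dual_ball s X N \<and> one_norming X N \<Gamma> \<and>
     (\<forall>\<epsilon>>0. \<forall>U. openin (subtopology (weak_star s X N) \<Gamma>) U \<and> U \<noteq> {} \<longrightarrow>
        (\<exists>V \<phi>\<^sub>1 e F. V \<noteq> {} \<and> V \<subseteq> U \<and> \<phi>\<^sub>1 \<in> V \<and> e \<in> X \<and> N e = 1 \<and> F \<in> Ops \<and>
           ack_base X N \<Gamma> \<epsilon> V \<phi>\<^sub>1 e F \<and>
           (\<forall>\<phi>\<in>\<Gamma> - ack_V1 X N \<Gamma> \<epsilon> F. norm (\<phi> (F e)) \<le> \<rho>)))"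

definition ack_simple ::
  "('k::real_or_complex \<Rightarrow> 'v \<Rightarrow> 'v) \<Rightarrow> 'v::ab_group_add set \<Rightarrow> ('v \<Rightarrow> real) \<Rightarrow> ('v \<Rightarrow> 'v) set
     \<Rightarrow> ('v \<Rightarrow> 'k) set \<Rightarrow> bool" where
  "ack_simple s X N Ops \<Gamma> \<longleftrightarrow>
     \<Gamma> \<subseteq> dual_ball s X N \<and> one_norming X N \<Gamma> \<and>
     (\<forall>\<epsilon>>0. \<forall>U. openin (subtopology (weak_star s X N) \<Gamma>) U \<and> U \<noteq> {} \<longrightarrow>
        (\<exists>V \<phi>\<^sub>1 e F. V \<noteq> {} \<and> V \<subseteq> U \<and> \<phi>\<^sub>1 \<in> V \<and> e \<in> X \<and> N e = 1 \<and> F \<in> Ops \<and>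
           ack_base X N \<Gamma> \<epsilon> V \<phi>\<^sub>1 e F \<and>
           ack_V1 X N \<Gamma> \<epsilon> F = \<Gamma>))"

section \<open>Function spaces\<close>

definition Cb :: "'z topology \<Rightarrow> ('t::topological_space \<Rightarrow> 'z::metric_space) set" where
  "Cb \<tau> = {x. continuous_map euclidean \<tau> x \<and> bounded (range x)}"

definition St :: "real \<Rightarrow> 'k::real_or_complex set" where
  "St \<epsilon> = {z. norm z + (1 - \<epsilon>) * norm (1 - z) \<le> 1}"

definition subalgebra_Cb :: "('t::topological_space \<Rightarrow> 'k::real_or_complex) set \<Rightarrow> bool" where
  "subalgebra_Cb A \<longleftrightarrow> A \<subseteq> Cb euclidean \<and> module.subspace (pointwise_scale (*)) A
     \<and> (\<forall>f\<in>A. \<forall>g\<in>A. (\<lambda>t. f t * g t) \<in> A)"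

definition ACK_subalgebra :: "('t::topological_space \<Rightarrow> 'k::real_or_complex) set \<Rightarrow> bool" where
  "ACK_subalgebra A \<longleftrightarrow> subalgebra_Cb A \<and>
     (\<forall>W \<epsilon>. open W \<and> W \<noteq> {} \<and> 0 < \<epsilon> \<and> \<epsilon> < 1 \<longrightarrow>
        (\<exists>f\<in>A. \<exists>t\<^sub>0\<in>W. f t\<^sub>0 = 1 \<and> sup_norm f = 1 \<and> (\<forall>t. t \<notin> W \<longrightarrow> norm (f t) < \<epsilon>)
           \<and> range f \<subseteq> St \<epsilon>))"

definition linear_topology ::
  "('k::real_or_complex \<Rightarrow> 'z \<Rightarrow> 'z) \<Rightarrow> 'z::ab_group_add topology \<Rightarrow> bool" where
  "linear_topology s \<tau> \<longleftrightarrow> topspace \<tau> = UNIV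
     \<and> continuous_map (prod_topology \<tau> \<tau>) \<tau> (\<lambda>(x, y). x + y)
     \<and> continuous_map (prod_topology euclidean \<tau>) \<tau> (\<lambda>(a, x). s a x)"

definition acceptable_topology ::
  "('k::real_or_complex \<Rightarrow> 'z \<Rightarrow> 'z) \<Rightarrow> ('z \<Rightarrow> 'k) set \<Rightarrow> 'z::real_normed_vector topology \<Rightarrow> bool" where
  "acceptable_topology s \<Gamma> \<tau> \<longleftrightarrow> linear_topology s \<tau>
     \<and> (\<forall>G. openin \<tau> G \<longrightarrow> open G)
     \<and> (\<forall>G. openin (weakest_topology UNIV \<Gamma>) G \<longrightarrow> openin \<tau> G)"

definition quasi_continuous :: "'a topology \<Rightarrow> 'b topology \<Rightarrow> ('a \<Rightarrow> 'b) \<Rightarrow> bool" where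
  "quasi_continuous A B f \<longleftrightarrow> f ` topspace A \<subseteq> topspace B \<and>
     (\<forall>U z V. openin A U \<and> z \<in> U \<and> openin B V \<and> f z \<in> V \<longrightarrow>
        (\<exists>W. openin A W \<and> W \<noteq> {} \<and> W \<subseteq> U \<and> f ` W \<subseteq> V))"

text \<open>The functional sending \<open>x\<close> to \<open>\<zeta> (x t)\<close>, normalised to vanish outside \<open>X\<close>.\<close>

definition delta_tensor :: "('t \<Rightarrow> 'z) set \<Rightarrow> 't \<Rightarrow> ('z \<Rightarrow> 'k::zero) \<Rightarrow> ('t \<Rightarrow> 'z) \<Rightarrow> 'k" where
  "delta_tensor X t \<zeta> = (\<lambda>x. if x \<in> X then \<zeta> (x t) else 0)"

end

theory Submission
  imports Defs
begin

text \<open>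
  Why the theorem holds. Fix \<open>\<epsilon>\<close> and a non-empty weak-star open \<open>U \<subseteq> \<Gamma>\<close>. A basic neighbourhood in
  \<open>U\<close> constrains only finitely many numbers \<open>\<zeta> (x\<^sub>k t)\<close>, so quasi-continuity of
  \<open>(t, \<zeta>) \<mapsto> (\<zeta> (x\<^sub>k t))\<^sub>k\<close> yields non-empty open sets \<open>W\<close> of points and \<open>UZ \<subseteq> \<Gamma>Z\<close> of functionals
  with \<open>\<delta>\<^sub>t \<otimes> \<zeta> \<in> U\<close> for all \<open>t \<in> W\<close> and \<open>\<zeta> \<in> UZ\<close> (\<open>delta_tensor_box\<close>). The ACK structure of \<open>Z\<close>
  on \<open>UZ\<close> supplies \<open>VZ\<close>, \<open>\<zeta>\<^sub>1\<close>, \<open>z\<close> and an operator \<open>G\<close>; the algebra supplies a function \<open>f\<close> peaking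
  at some \<open>t\<^sub>1 \<in> W\<close>, small off \<open>W\<close>, with values in \<open>St \<eta>\<close>, a thin region around
  the segment from 0 to 1.

  It remains to combine the two (\<open>ack_step_lift\<close>). The natural candidates \<open>e = f \<otimes> z\<close> and
  \<open>F x = f \<cdot> (G \<circ> x)\<close> fail, because at points of \<open>W\<close> where \<open>f\<close> is neither near 0 nor near 1 the
  functional \<open>F\<^sup>* (\<delta>\<^sub>t \<otimes> \<zeta>)\<close> is not small, while \<open>(\<delta>\<^sub>t \<otimes> \<zeta>) e\<close> is not near 1. The remedy is to use
  a high power in the operator only: \<open>F x = f\<^sup>n \<cdot> (G \<circ> x)\<close>. Where \<open>|f\<^sup>n| \<ge> \<eta>\<close>, the modulus \<open>|f|\<close> is
  close to 1, and inside \<open>St \<eta>\<close> this forces \<open>f\<close> itself to be close to 1. So with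
  \<open>V = {\<delta>\<^sub>t \<otimes> \<zeta> | t \<in> W, |f t|\<^sup>n \<ge> \<eta>, \<zeta> \<in> VZ}\<close> all \<open>v \<in> V\<close> satisfy (VI), while for the
  remaining \<open>t\<close> the functional \<open>F\<^sup>* (\<delta>\<^sub>t \<otimes> \<zeta>)\<close> is within \<open>\<epsilon>\<close> of 0, as (V) requires.

  The inequality that defines \<open>V\<^sub>1\<close> survives because \<open>St \<eta>\<close> is closed under multiplication
  (\<open>St_mult\<close>), so that \<open>m = f\<^sup>n\<close> still takes values in it: from
  \<open>\<zeta> - m G\<^sup>*\<zeta> = m (\<zeta> - G\<^sup>*\<zeta>) + (1 - m) \<zeta>\<close> one gets
  \<open>\<parallel>m G\<^sup>*\<zeta>\<parallel> + (1 - \<eta>) \<parallel>\<zeta> - m G\<^sup>*\<zeta>\<parallel> \<le> |m| + (1 - \<eta>) |1 - m| \<le> 1\<close> whenever \<open>\<zeta>\<close> satisfies the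
  corresponding inequality for \<open>G\<close>. Thus \<open>\<zeta> \<in> V\<^sub>1\<close> for \<open>Z\<close> implies \<open>\<delta>\<^sub>t \<otimes> \<zeta> \<in> V\<^sub>1\<close> for \<open>X\<close>, which
  carries over both versions of condition (IV) at once.
\<close>

section \<open>Bounded functionals and their norms\<close>

lemma operator_norm_least:
  assumes "normed_space_on s X N" "\<And>x. x \<in> X \<Longrightarrow> N x \<le> 1 \<Longrightarrow> M (f x) \<le> C"
  shows "operator_norm X N M f \<le> C"
proof -
  interpret normed_space_on s X N by fact
  have 0: "0 \<in> X" using subspace_carrier by (rule subspace_0)
  then have "N 0 \<le> 1" using norm_eq_zero[of 0] by simp
  then show ?thesis unfolding operator_norm_def using 0 assms(2) by (intro cSUP_least) auto
qed

lemma dualD: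
  assumes "\<phi> \<in> dual s X N"
  shows "x \<in> X \<Longrightarrow> y \<in> X \<Longrightarrow> \<phi> (x + y) = \<phi> x + \<phi> y"
    and "x \<in> X \<Longrightarrow> \<phi> (s a x) = a * \<phi> x"
    and "x \<notin> X \<Longrightarrow> \<phi> x = 0"
  using assms by (auto simp: dual_def bounded_linear_maps_def)

lemma bounded_operatorsD:
  assumes "F \<in> bounded_operators s X N"
  shows "x \<in> X \<Longrightarrow> F x \<in> X"
    and "x \<in> X \<Longrightarrow> y \<in> X \<Longrightarrow> F (x + y) = F x + F y"
    and "x \<in> X \<Longrightarrow> F (s a x) = s a (F x)"
    and "x \<notin> X \<Longrightarrow> F x = 0"
  using assms by (auto simp: bounded_operators_def bounded_linear_maps_def)

lemma bound_by_operator_norm: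
  assumes "normed_space_on s X N" "f \<in> bounded_linear_maps s X N s' Y M"
    and hom: "\<And>a y. y \<in> Y \<Longrightarrow> M (s' a y) = norm a * M y" and x: "x \<in> X"
  shows "M (f x) \<le> operator_norm X N M f * N x"
proof -
  interpret normed_space_on s X N by fact
  obtain C where f: "\<And>x. x \<in> X \<Longrightarrow> f x \<in> Y" "\<And>a x. x \<in> X \<Longrightarrow> f (s a x) = s' a (f x)"
    and C: "\<And>x. x \<in> X \<Longrightarrow> M (f x) \<le> C * N x"
    using assms(2) unfolding bounded_linear_maps_def by blast
  show ?thesis
  proof (cases "x = 0")
    case True
    then have "N x = 0" using norm_eq_zero x by simp
    with C[OF x] show ?thesis by simp
  next
    case False
    then have pos: "N x > 0" using norm_nonneg[OF x] norm_eq_zero[OF x] by linarith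
    define y where "y = s (of_real (1 / N x)) x"
    have y: "y \<in> X" unfolding y_def using x subspace_carrier by (simp add: subspace_scale)
    have Ny: "N y = 1" unfolding y_def using pos by (simp add: norm_scale[OF x] norm_divide)
    have "bdd_above ((\<lambda>x. M (f x)) ` {x \<in> X. N x \<le> 1})"
    proof (rule bdd_aboveI2)
      fix z assume "z \<in> {x \<in> X. N x \<le> 1}"
      then have z: "z \<in> X" "N z \<le> 1" by auto
      have "C * N z \<le> \<bar>C\<bar> * 1"
        using z norm_nonneg[of z] by (intro mult_mono) auto
      then show "M (f z) \<le> \<bar>C\<bar>" using C[OF z(1)] by simp
    qed
    then have "M (f y) \<le> operator_norm X N M f"
      unfolding operator_norm_def using y Ny by (intro cSUP_upper) auto
    moreover have "M (f y) = M (f x) / N x"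
      unfolding y_def using pos by (simp add: f x hom norm_divide)
    ultimately show ?thesis using pos by (simp add: field_simps)
  qed
qed

lemma norm_dual_le:
  assumes "normed_space_on s X N" "\<phi> \<in> dual s X N" "x \<in> X"
  shows "norm (\<phi> x) \<le> dual_norm X N \<phi> * N x"
  using bound_by_operator_norm[OF assms(1) assms(2)[unfolded dual_def] _ assms(3)]
  by (simp add: norm_mult)

lemma dual_norm_nonneg:
  assumes X: "normed_space_on s X N" and \<phi>: "\<phi> \<in> dual s X N"
  shows "0 \<le> dual_norm X N \<phi>"
proof (cases "\<exists>x\<in>X. x \<noteq> 0")
  case True
  then obtain x where x: "x \<in> X" "x \<noteq> 0" by auto
  interpret normed_space_on s X N by fact
  have "N x > 0" using x norm_nonneg norm_eq_zero by (metis order_le_less)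
  moreover have "0 \<le> dual_norm X N \<phi> * N x"
    using norm_dual_le[OF X \<phi> x(1)] norm_ge_zero order_trans by blast
  ultimately show ?thesis by (simp add: zero_le_mult_iff)
next
  case False
  interpret normed_space_on s X N by fact
  have "X = {0}" using False subspace_0[OF subspace_carrier] by auto
  moreover have "N 0 = 0" using calculation norm_eq_zero by simp
  ultimately have "{x \<in> X. N x \<le> 1} = {0}" by auto
  then show ?thesis by (simp add: operator_norm_def)
qed

lemma norm_dual_ball_le:
  assumes "normed_space_on s X N" "\<phi> \<in> dual_ball s X N" "x \<in> X"
  shows "norm (\<phi> x) \<le> N x"
proof -
  interpret normed_space_on s X N by fact
  have "norm (\<phi> x) \<le> dual_norm X N \<phi> * N x"
    using assms by (intro norm_dual_le) (auto simp: dual_ball_def)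
  also have "\<dots> \<le> 1 * N x"
    using assms by (intro mult_right_mono norm_nonneg) (auto simp: dual_ball_def)
  finally show ?thesis by simp
qed

lemma norm_operator_le:
  assumes "normed_space_on s X N" "F \<in> bounded_operators s X N" "x \<in> X"
  shows "N (F x) \<le> operator_norm X N N F * N x"
proof -
  interpret normed_space_on s X N by fact
  show ?thesis
    using assms(1) assms(2)[unfolded bounded_operators_def] norm_scale assms(3)
    by (rule bound_by_operator_norm)
qed

lemma dualI:
  assumes "\<And>x y. x \<in> X \<Longrightarrow> y \<in> X \<Longrightarrow> \<phi> (x + y) = \<phi> x + \<phi> y"
    and "\<And>a x. x \<in> X \<Longrightarrow> \<phi> (s a x) = a * \<phi> x"
    and "\<And>x. x \<notin> X \<Longrightarrow> \<phi> x = 0"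
    and "\<And>x. x \<in> X \<Longrightarrow> norm (\<phi> x) \<le> C * N x"
  shows "\<phi> \<in> dual s X N"
  unfolding dual_def bounded_linear_maps_def using assms by blast

lemma dual_lincomb:
  assumes X: "normed_space_on s X N" and "\<phi> \<in> dual s X N" "\<psi> \<in> dual s X N"
  shows "pointwise_scale (*) a \<phi> + pointwise_scale (*) b \<psi> \<in> dual s X N"
proof (rule dualI)
  fix x assume x: "x \<in> X"
  have "norm (a * \<phi> x + b * \<psi> x) \<le> norm a * norm (\<phi> x) + norm b * norm (\<psi> x)"
    by (metis norm_mult norm_triangle_ineq)
  also have "\<dots> \<le> norm a * (dual_norm X N \<phi> * N x) + norm b * (dual_norm X N \<psi> * N x)"
    by (intro add_mono mult_left_mono norm_dual_le[OF X] assms x norm_ge_zero)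
  also have "\<dots> = (norm a * dual_norm X N \<phi> + norm b * dual_norm X N \<psi>) * N x"
    by (simp add: algebra_simps)
  finally show "norm ((pointwise_scale (*) a \<phi> + pointwise_scale (*) b \<psi>) x)
      \<le> (norm a * dual_norm X N \<phi> + norm b * dual_norm X N \<psi>) * N x"
    by (simp add: pointwise_scale_def)
qed (use assms in \<open>auto simp: pointwise_scale_def dualD algebra_simps\<close>)

lemma dual_diff:
  assumes "normed_space_on s X N" "\<phi> \<in> dual s X N" "\<psi> \<in> dual s X N"
  shows "\<phi> - \<psi> \<in> dual s X N"
proof -
  have "\<phi> - \<psi> = pointwise_scale (*) 1 \<phi> + pointwise_scale (*) (-1) \<psi>"
    by (auto simp: pointwise_scale_def fun_eq_iff)
  then show ?thesis using dual_lincomb[OF assms, of 1 "-1"] by simp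
qed

lemma adjoint_in_dual:
  assumes X: "normed_space_on s X N" and \<phi>: "\<phi> \<in> dual s X N" and F: "F \<in> bounded_operators s X N"
  shows "adjoint_map F \<phi> \<in> dual s X N"
proof -
  interpret normed_space_on s X N by fact
  have 0: "0 \<in> X" using subspace_0[OF subspace_carrier] .
  have \<phi>0: "\<phi> 0 = 0" using dualD(1)[OF \<phi> 0 0] by simp
  show ?thesis
  proof (rule dualI)
    fix x assume x: "x \<in> X"
    have "norm (\<phi> (F x)) \<le> dual_norm X N \<phi> * N (F x)"
      by (rule norm_dual_le[OF X \<phi> bounded_operatorsD(1)[OF F x]])
    also have "\<dots> \<le> dual_norm X N \<phi> * (operator_norm X N N F * N x)"
      by (intro mult_left_mono dual_norm_nonneg[OF X \<phi>] norm_operator_le[OF X F x])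
    finally show "norm (adjoint_map F \<phi> x) \<le> (dual_norm X N \<phi> * operator_norm X N N F) * N x"
      by (simp add: adjoint_map_def mult.assoc)
  qed (auto simp: adjoint_map_def dualD[OF \<phi>] bounded_operatorsD[OF F] \<phi>0)
qed

lemma absolutely_convex_aco: "absolutely_convex (pointwise_scale (*)) (aco V)"
  unfolding aco_def by (rule hull_in) (auto simp: absolutely_convex_def)

lemma aco_induct [consumes 1]:
  assumes "\<psi> \<in> aco V" "\<And>\<psi>. \<psi> \<in> V \<Longrightarrow> P \<psi>"
    and "\<And>\<phi> \<psi> a b. P \<phi> \<Longrightarrow> P \<psi> \<Longrightarrow> norm a + norm b \<le> 1
           \<Longrightarrow> P (pointwise_scale (*) a \<phi> + pointwise_scale (*) b \<psi>)"
  shows "P \<psi>"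
proof -
  have "aco V \<subseteq> Collect P"
    unfolding aco_def using assms(2,3)
    by (intro hull_minimal) (auto simp: absolutely_convex_def)
  with assms(1) show ?thesis by auto
qed

text \<open>\<open>operator_norm\<close> is a supremum that is meaningful only on bounded functionals, so every element
  of the hull has to be known to be bounded before its distance to another functional is estimated.\<close>

lemma aco_in_dual:
  assumes "normed_space_on s X N" "\<psi> \<in> aco ({0} \<union> V)" "V \<subseteq> dual s X N"
  shows "\<psi> \<in> dual s X N"
  using assms(2)
proof (induction rule: aco_induct)
  case (1 \<psi>)
  moreover have "0 \<in> dual s X N" by (rule dualI[where C = 0]) auto
  ultimately show ?case using assms(3) by auto
next
  case (2 \<phi> \<psi> a b)
  then show ?case using dual_lincomb[OF assms(1)] by blast
qed

lemma dual_dist_le: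
  assumes "normed_space_on s X N" "\<phi> \<in> dual s X N" "V \<subseteq> dual s X N" "\<psi> \<in> aco ({0} \<union> V)"
  shows "dual_dist X N \<phi> (aco ({0} \<union> V)) \<le> dual_norm X N (\<phi> - \<psi>)"
  unfolding dual_dist_def
proof (rule cINF_lower[OF _ assms(4)])
  show "bdd_below ((\<lambda>\<psi>. dual_norm X N (\<phi> - \<psi>)) ` aco ({0} \<union> V))"
    using dual_norm_nonneg[OF assms(1) dual_diff[OF assms(1,2) aco_in_dual[OF assms(1) _ assms(3)]]]
    by (intro bdd_belowI2[where m = 0])
qed

section \<open>The range of a peaking function\<close>

lemma St_norm_le_1: "z \<in> St \<delta> \<Longrightarrow> \<delta> \<le> 1 \<Longrightarrow> norm z \<le> 1"
  using mult_nonneg_nonneg[of "1 - \<delta>" "norm (1 - z)"] unfolding St_def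
  by (simp del: mult_nonneg_nonneg zero_le_mult_iff)

text \<open>For \<open>\<delta> < 1\<close>, membership in \<open>St \<delta>\<close> reads \<open>|1 - z| \<le> (1 - |z|) / (1 - \<delta>)\<close>. This is stable under
  products since \<open>1 - z w = (1 - z) + z (1 - w)\<close> and \<open>(1 - |z|) + |z| (1 - |w|) = 1 - |z w|\<close>.\<close>

lemma St_mult:
  assumes "z \<in> St \<delta>" "w \<in> St \<delta>" "\<delta> \<le> 1"
  shows "z * w \<in> St \<delta>"
proof -
  have "norm (1 - z * w) \<le> norm (1 - z) + norm z * norm (1 - w)"
    using norm_triangle_ineq[of "1 - z" "z * (1 - w)"] unfolding norm_mult
    by (simp add: right_diff_distrib)
  then have "(1 - \<delta>) * norm (1 - z * w) \<le> (1 - \<delta>) * (norm (1 - z) + norm z * norm (1 - w))"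
    using assms(3) by (intro mult_left_mono) auto
  also have "\<dots> = (1 - \<delta>) * norm (1 - z) + norm z * ((1 - \<delta>) * norm (1 - w))"
    by (simp add: algebra_simps)
  also have "\<dots> \<le> (1 - norm z) + norm z * (1 - norm w)"
    using assms(1,2) by (intro add_mono mult_left_mono) (auto simp: St_def)
  finally show ?thesis by (simp add: St_def norm_mult algebra_simps)
qed

lemma St_power:
  assumes "z \<in> St \<delta>" "\<delta> \<le> 1"
  shows "z ^ n \<in> St \<delta>"
  by (induction n) (use assms in \<open>auto simp: St_mult\<close>, simp add: St_def)

section \<open>Functionals of the form \<open>\<delta>\<^sub>t \<otimes> \<zeta>\<close>\<close>

locale bounded_function_space =
  Z: normed_space_on s "UNIV :: 'z set" norm +
  X: normed_space_on "pointwise_scale s" X sup_norm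
  for s :: "'k::real_or_complex \<Rightarrow> 'z::real_normed_vector \<Rightarrow> 'z" and X :: "('t \<Rightarrow> 'z) set" +
  assumes bounded_range: "x \<in> X \<Longrightarrow> bounded (range x)"
begin

abbreviation "sX \<equiv> pointwise_scale s"

lemma norm_le_sup_norm: "x \<in> X \<Longrightarrow> norm (x t) \<le> sup_norm x"
  unfolding sup_norm_def using bounded_range[of x]
  by (intro cSUP_upper) (auto simp: bounded_iff bdd_above_def)

lemma sup_norm_le: "(\<And>t. norm (x t) \<le> C) \<Longrightarrow> sup_norm x \<le> C"
  for x :: "'t \<Rightarrow> 'z"
  unfolding sup_norm_def by (intro cSUP_least) auto

lemma sup_norm_eq_1I:
  assumes "x \<in> X" "\<And>t. norm (x t) \<le> 1" "norm (x t) = 1"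
  shows "sup_norm x = 1"
  using sup_norm_le[of x 1] norm_le_sup_norm[OF assms(1), of t] assms(2,3) by simp

lemma plus_in_X: "x \<in> X \<Longrightarrow> y \<in> X \<Longrightarrow> x + y \<in> X"
  using X.subspace_add[OF X.subspace_carrier] .

lemma scale_in_X: "x \<in> X \<Longrightarrow> sX a x \<in> X"
  using X.subspace_scale[OF X.subspace_carrier] .

lemma delta_tensor_apply: "x \<in> X \<Longrightarrow> delta_tensor X t \<zeta> x = \<zeta> (x t)"
  by (simp add: delta_tensor_def)

lemma delta_tensor_lincomb:
  "delta_tensor X t (pointwise_scale (*) a \<phi> + pointwise_scale (*) b \<psi>) =
     pointwise_scale (*) a (delta_tensor X t \<phi>) + pointwise_scale (*) b (delta_tensor X t \<psi>)"
  for a b :: 'k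
  by (auto simp: delta_tensor_def pointwise_scale_def fun_eq_iff)

lemma norm_delta_tensor_le:
  assumes "\<zeta> \<in> dual s UNIV norm" "x \<in> X"
  shows "norm (delta_tensor X t \<zeta> x) \<le> dual_norm UNIV norm \<zeta> * sup_norm x"
proof -
  have "norm (delta_tensor X t \<zeta> x) \<le> dual_norm UNIV norm \<zeta> * norm (x t)"
    using norm_dual_le[OF Z.normed_space_on_axioms assms(1)] assms(2) by (simp add: delta_tensor_apply)
  also have "\<dots> \<le> dual_norm UNIV norm \<zeta> * sup_norm x"
    by (intro mult_left_mono norm_le_sup_norm assms dual_norm_nonneg[OF Z.normed_space_on_axioms])
  finally show ?thesis .
qed

lemma delta_tensor_in_dual:
  assumes "\<zeta> \<in> dual s UNIV norm"
  shows "delta_tensor X t \<zeta> \<in> dual sX X sup_norm"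
  by (rule dualI[OF _ _ _ norm_delta_tensor_le[OF assms]])
     (auto simp: delta_tensor_def plus_in_X scale_in_X dualD[OF assms], 
      auto simp: pointwise_scale_def dualD[OF assms])

lemma dual_norm_delta_tensor_le:
  assumes "\<zeta> \<in> dual s UNIV norm"
  shows "dual_norm X sup_norm (delta_tensor X t \<zeta>) \<le> dual_norm UNIV norm \<zeta>"
proof (rule operator_norm_least[OF X.normed_space_on_axioms])
  fix x assume x: "x \<in> X" "sup_norm x \<le> 1"
  have "dual_norm UNIV norm \<zeta> * sup_norm x \<le> dual_norm UNIV norm \<zeta> * 1"
    by (intro mult_left_mono x dual_norm_nonneg[OF Z.normed_space_on_axioms assms])
  then show "norm (delta_tensor X t \<zeta> x) \<le> dual_norm UNIV norm \<zeta>"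
    using norm_delta_tensor_le[OF assms x(1), of t] by simp
qed

lemma delta_tensor_in_dual_ball:
  "\<zeta> \<in> dual_ball s UNIV norm \<Longrightarrow> delta_tensor X t \<zeta> \<in> dual_ball sX X sup_norm"
  using delta_tensor_in_dual dual_norm_delta_tensor_le order_trans
  unfolding dual_ball_def by blast

lemma delta_tensor_aco:
  fixes \<psi> :: "'z \<Rightarrow> 'k"
  assumes "\<psi> \<in> aco ({0} \<union> VZ)" "\<And>\<zeta>. \<zeta> \<in> VZ \<Longrightarrow> delta_tensor X t \<zeta> \<in> V"
  shows "delta_tensor X t \<psi> \<in> aco ({0} \<union> V)"
  using assms(1)
proof (induction rule: aco_induct)
  case (1 \<psi>)
  have "delta_tensor X t (0 :: 'z \<Rightarrow> 'k) = 0"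
    by (auto simp: delta_tensor_def fun_eq_iff)
  then have "delta_tensor X t \<psi> \<in> {0} \<union> V" using 1 assms(2) by auto
  then show ?case unfolding aco_def by (rule hull_inc)
next
  case (2 \<phi> \<psi> a b)
  then show ?case
    using absolutely_convex_aco[of "{0} \<union> V"]
    unfolding delta_tensor_lincomb absolutely_convex_def by blast
qed

text \<open>The norm of \<open>x\<close> is an iterated supremum, over \<open>t\<close> and then over \<open>\<Gamma>Z\<close>. An empty \<open>\<Gamma>Z\<close> makes
  every norm in \<open>Z\<close> equal to the supremum of the empty set, and then both sides have this value.\<close>

lemma one_norming_delta_tensor:
  assumes ball: "\<Gamma>Z \<subseteq> dual_ball s UNIV norm" and norming: "one_norming UNIV norm \<Gamma>Z"
  shows "one_norming X sup_norm {delta_tensor X t \<zeta> | t \<zeta>. \<zeta> \<in> \<Gamma>Z}"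
  unfolding one_norming_def
proof
  fix x assume x: "x \<in> X"
  have norm_Z: "norm z = (SUP \<zeta>\<in>\<Gamma>Z. norm (\<zeta> z))" for z
    using norming by (auto simp: one_norming_def)
  let ?\<Gamma> = "{delta_tensor X t \<zeta> | t \<zeta>. \<zeta> \<in> \<Gamma>Z}"
  show "sup_norm x = (SUP \<phi>\<in>?\<Gamma>. norm (\<phi> x))"
  proof (cases "\<Gamma>Z = {}")
    case True
    then have "norm z = Sup {}" for z :: 'z using norm_Z[of z] by simp
    then have "sup_norm x = Sup {}" by (simp add: sup_norm_def)
    then show ?thesis using True by simp
  next
    case False
    have upper: "norm (\<phi> x) \<le> sup_norm x" if "\<phi> \<in> ?\<Gamma>" for \<phi>
      using that norm_dual_ball_le[OF X.normed_space_on_axioms delta_tensor_in_dual_ball x] ball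
      by blast
    have bdd: "bdd_above ((\<lambda>\<phi>. norm (\<phi> x)) ` ?\<Gamma>)"
      using upper by (intro bdd_aboveI2)
    show ?thesis
    proof (rule antisym)
      have "norm (x t) \<le> (SUP \<phi>\<in>?\<Gamma>. norm (\<phi> x))" for t
        unfolding norm_Z[of "x t"]
      proof (rule cSUP_least[OF False])
        fix \<zeta> assume "\<zeta> \<in> \<Gamma>Z"
        then have "norm (delta_tensor X t \<zeta> x) \<le> (SUP \<phi>\<in>?\<Gamma>. norm (\<phi> x))"
          by (intro cSUP_upper bdd) auto
        then show "norm (\<zeta> (x t)) \<le> (SUP \<phi>\<in>?\<Gamma>. norm (\<phi> x))"
          by (simp add: delta_tensor_apply x)
      qed
      then show "sup_norm x \<le> (SUP \<phi>\<in>?\<Gamma>. norm (\<phi> x))" by (rule sup_norm_le)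
      show "(SUP \<phi>\<in>?\<Gamma>. norm (\<phi> x)) \<le> sup_norm x"
        using False by (intro cSUP_least upper) auto
    qed
  qed
qed

section \<open>Weighted compositions\<close>

text \<open>The value 0 outside \<open>X\<close> is the normal form of bounded operators on \<open>X\<close>.\<close>

definition weighted_composition :: "('t \<Rightarrow> 'k) \<Rightarrow> ('z \<Rightarrow> 'z) \<Rightarrow> ('t \<Rightarrow> 'z) \<Rightarrow> ('t \<Rightarrow> 'z)" where
  "weighted_composition m G x = (if x \<in> X then \<lambda>t. s (m t) (G (x t)) else 0)"

lemma weighted_composition_bounded_operator:
  assumes G: "G \<in> bounded_operators s UNIV norm" "operator_norm UNIV norm norm G = 1"
    and m: "\<And>t. norm (m t) \<le> 1" and maps: "\<And>x. x \<in> X \<Longrightarrow> weighted_composition m G x \<in> X"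
  shows "weighted_composition m G \<in> bounded_operators sX X sup_norm"
    and "\<And>x. x \<in> X \<Longrightarrow> sup_norm (weighted_composition m G x) \<le> sup_norm x"
proof -
  show bound: "sup_norm (weighted_composition m G x) \<le> sup_norm x" if x: "x \<in> X" for x
  proof (rule sup_norm_le)
    fix t
    have "norm (m t) * norm (G (x t)) \<le> 1 * norm (x t)"
      using norm_operator_le[OF Z.normed_space_on_axioms G(1), of "x t"] G(2) m
      by (intro mult_mono) auto
    then show "norm (weighted_composition m G x t) \<le> sup_norm x"
      using norm_le_sup_norm[OF x, of t] x by (simp add: weighted_composition_def Z.norm_scale)
  qed
  then have "\<forall>x\<in>X. sup_norm (weighted_composition m G x) \<le> 1 * sup_norm x" by simp
  then show "weighted_composition m G \<in> bounded_operators sX X sup_norm"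
    unfolding bounded_operators_def bounded_linear_maps_def mem_Collect_eq
  proof (intro conjI ballI allI impI exI[of _ 1])
    fix x y assume x: "x \<in> X" and y: "y \<in> X"
    then show "weighted_composition m G (x + y) = weighted_composition m G x + weighted_composition m G y"
      using plus_in_X[OF x y]
      by (auto simp: weighted_composition_def bounded_operatorsD[OF G(1)] Z.scale_right_distrib)
  next
    fix a x assume x: "x \<in> X"
    then show "weighted_composition m G (sX a x) = sX a (weighted_composition m G x)"
      using scale_in_X[OF x, of a]
      by (auto simp: weighted_composition_def pointwise_scale_def bounded_operatorsD[OF G(1)] mult.commute)
  qed (use maps in \<open>auto simp: weighted_composition_def\<close>)
qed

text \<open>Weighted compositions act on the functionals \<open>\<delta>\<^sub>t \<otimes> \<zeta>\<close> fibrewise: the point \<open>t\<close> is kept, and \<open>\<zeta>\<close>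
  is replaced by a scalar multiple of its image under the adjoint of \<open>G\<close>. All estimates about
  \<open>F\<^sup>*\<close> on \<open>\<Gamma>\<close> thereby reduce to estimates in the dual of \<open>Z\<close>.\<close>

lemma adjoint_weighted_composition:
  assumes G: "G \<in> bounded_operators s UNIV norm" and \<zeta>: "\<zeta> \<in> dual s UNIV norm"
    and maps: "\<And>x. x \<in> X \<Longrightarrow> weighted_composition m G x \<in> X"
  shows "adjoint_map (weighted_composition m G) (delta_tensor X t \<zeta>) =
           delta_tensor X t (pointwise_scale (*) (m t) (adjoint_map G \<zeta>))"
proof
  fix x
  have "\<zeta> 0 = 0" using dualD(1)[OF \<zeta>, of 0 0] by simp
  then show "adjoint_map (weighted_composition m G) (delta_tensor X t \<zeta>) x =
           delta_tensor X t (pointwise_scale (*) (m t) (adjoint_map G \<zeta>)) x"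
    using maps[of x]
    by (cases "x \<in> X")
      (auto simp: adjoint_map_def delta_tensor_def pointwise_scale_def weighted_composition_def
        dualD[OF \<zeta>])
qed


section \<open>Lifting one step of an ACK structure\<close>

text \<open>The witnesses are \<open>e = f \<otimes> z\<close> and \<open>F x = f\<^sup>n \<cdot> (G \<circ> x)\<close>, with \<open>n\<close> so large that \<open>|f t|\<^sup>n \<ge> \<eta>\<close>
  forces \<open>f t\<close> to be close to 1. The last two conclusions compare \<open>F\<close> with \<open>G\<close> fibrewise; either
  version of condition (IV) for \<open>F\<close> follows from them and the same version for \<open>G\<close>.
  The factor 2 in \<open>2 * \<eta> \<le> \<epsilon>\<close> pays for the two errors \<open>|1 - f t|\<close> and \<open>|\<zeta> z - 1|\<close> in (VI).\<close>

lemma ack_step_lift: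
  fixes \<Gamma>Z :: "('z \<Rightarrow> 'k) set"
  assumes \<eta>: "0 < \<eta>" "\<eta> \<le> 1 / 2" "2 * \<eta> \<le> \<epsilon>"
    and \<Gamma>Z: "\<Gamma>Z \<subseteq> dual_ball s UNIV norm"
    and VZ: "VZ \<subseteq> \<Gamma>Z" "\<zeta>\<^sub>1 \<in> VZ" and G: "G \<in> bounded_operators s UNIV norm" and z: "norm z = 1"
    and base: "ack_base UNIV norm \<Gamma>Z \<eta> VZ \<zeta>\<^sub>1 z G"
    and f: "f t\<^sub>1 = 1" "t\<^sub>1 \<in> W" "\<And>t. t \<notin> W \<Longrightarrow> norm (f t) < \<eta>" "range f \<subseteq> St \<eta>"
    and f_mult: "\<And>x. x \<in> X \<Longrightarrow> (\<lambda>t. s (f t) (x t)) \<in> X"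
    and G_comp: "\<And>x. x \<in> X \<Longrightarrow> G \<circ> x \<in> X"
    and f_tensor: "(\<lambda>t. s (f t) z) \<in> X"
  obtains V \<phi>\<^sub>1 e F where
    "V \<subseteq> {delta_tensor X t \<zeta> | t \<zeta>. t \<in> W \<and> \<zeta> \<in> VZ}" "\<phi>\<^sub>1 \<in> V"
    "e \<in> X" "sup_norm e = 1" "F \<in> bounded_operators sX X sup_norm"
    "ack_base X sup_norm {delta_tensor X t \<zeta> | t \<zeta>. \<zeta> \<in> \<Gamma>Z} \<epsilon> V \<phi>\<^sub>1 e F"
    "\<And>t \<zeta>. \<zeta> \<in> ack_V1 UNIV norm \<Gamma>Z \<eta> G \<Longrightarrow>
       delta_tensor X t \<zeta> \<in> ack_V1 X sup_norm {delta_tensor X t \<zeta> | t \<zeta>. \<zeta> \<in> \<Gamma>Z} \<epsilon> F"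
    "\<And>t \<zeta>. \<zeta> \<in> \<Gamma>Z \<Longrightarrow> norm (delta_tensor X t \<zeta> (F e)) \<le> norm (\<zeta> (G z))"
proof -
  note nZ = Z.normed_space_on_axioms and nX = X.normed_space_on_axioms
  let ?\<Gamma> = "{delta_tensor X t \<zeta> | t \<zeta>. \<zeta> \<in> \<Gamma>Z}"
  have \<Gamma>Z_dual: "\<Gamma>Z \<subseteq> dual s UNIV norm" using \<Gamma>Z by (auto simp: dual_ball_def)
  have Gz: "norm (G z) = 1" "operator_norm UNIV norm norm G = 1" "\<zeta>\<^sub>1 (G z) = 1"
      "adjoint_map G \<zeta>\<^sub>1 = \<zeta>\<^sub>1"
    and dist: "\<And>\<zeta>. \<zeta> \<in> \<Gamma>Z \<Longrightarrow> dual_dist UNIV norm (adjoint_map G \<zeta>) (aco ({0} \<union> VZ)) < \<eta>"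
    and near: "\<And>\<zeta>. \<zeta> \<in> VZ \<Longrightarrow> norm (\<zeta> z - 1) \<le> \<eta>"
    using base by (auto simp: ack_base_def)
  have adj_dual: "adjoint_map G \<zeta> \<in> dual s UNIV norm" if "\<zeta> \<in> \<Gamma>Z" for \<zeta>
    using adjoint_in_dual[OF nZ _ G] that \<Gamma>Z_dual by blast
  have "(1 - \<eta> / 2) < 1" "0 \<le> 1 - \<eta> / 2" using \<eta> by auto
  \<comment> \<open>For \<open>n\<close> as follows, if \<open>|f t|\<^sup>n \<ge> \<eta>\<close>, then \<open>|f t| > 1 - \<eta> / 2\<close>; as \<open>f t \<in> St \<eta>\<close> and
    \<open>1 - \<eta> \<ge> 1 / 2\<close>, the distance of \<open>f t\<close> from 1 is at most \<open>\<eta>\<close>.\<close>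
  then obtain n where n: "(1 - \<eta> / 2) ^ n < \<eta>"
    using real_arch_pow_inv[of \<eta> "1 - \<eta> / 2"] \<eta> by auto
  then have "n \<noteq> 0" using \<eta> by (intro notI) auto
  define m where "m t = f t ^ n" for t
  have m1: "m t\<^sub>1 = 1" by (simp add: m_def f)
  have f_le: "norm (f t) \<le> 1" for t
    using f(4) \<eta> by (intro St_norm_le_1[of _ \<eta>]) auto
  have m_le: "norm (m t) \<le> 1" for t
    using f_le by (simp add: m_def norm_power power_le_one)
  have m_le_f: "norm (m t) \<le> norm (f t)" for t
    using power_decreasing[of 1 n "norm (f t)"] f_le \<open>n \<noteq> 0\<close> by (simp add: m_def norm_power)
  have m_St: "norm (m t) + (1 - \<eta>) * norm (1 - m t) \<le> 1" for t
    using St_power[of "f t" \<eta> n] f(4) \<eta> by (auto simp: m_def St_def)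
  have f_near: "norm (1 - f t) \<le> \<eta>" if "norm (m t) \<ge> \<eta>" for t
  proof -
    have "1 - \<eta> / 2 \<le> norm (f t)"
    proof (rule ccontr)
      assume "\<not> 1 - \<eta> / 2 \<le> norm (f t)"
      then have "norm (f t) ^ n \<le> (1 - \<eta> / 2) ^ n" by (intro power_mono) auto
      with n that show False by (simp add: m_def norm_power)
    qed
    moreover have "norm (f t) + (1 - \<eta>) * norm (1 - f t) \<le> 1"
      using f(4) by (auto simp: St_def)
    moreover have "(1 / 2) * norm (1 - f t) \<le> (1 - \<eta>) * norm (1 - f t)"
      using \<eta> by (intro mult_right_mono) auto
    ultimately show ?thesis by linarith
  qed
  define F where "F = weighted_composition m G"
  define e where "e = (\<lambda>t. s (f t) z)"
  \<comment> \<open>Stability under multiplication by \<open>f\<close> gives stability under all its powers, by iteration.\<close>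
  have m_mult: "(\<lambda>t. s (f t ^ k) (x t)) \<in> X" if x: "x \<in> X" for k x
  proof (induction k)
    case (Suc k)
    from f_mult[OF Suc] show ?case by simp
  qed (use x in simp)
  have maps: "weighted_composition m G x \<in> X" if "x \<in> X" for x
    using m_mult[OF G_comp[OF that], of n] that by (simp add: weighted_composition_def m_def)
  then have F_maps: "F x \<in> X" if "x \<in> X" for x using that by (simp add: F_def)
  have F_op: "F \<in> bounded_operators sX X sup_norm"
    unfolding F_def using G Gz(2) m_le maps by (rule weighted_composition_bounded_operator)
  have F_le: "sup_norm (F x) \<le> sup_norm x" if "x \<in> X" for x
    unfolding F_def using G Gz(2) m_le maps that by (rule weighted_composition_bounded_operator)
  have adj: "adjoint_map F (delta_tensor X t \<zeta>) =
      delta_tensor X t (pointwise_scale (*) (m t) (adjoint_map G \<zeta>))"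
    if "\<zeta> \<in> dual s UNIV norm" for t \<zeta>
    unfolding F_def using G that maps by (rule adjoint_weighted_composition)
  have e: "e \<in> X" using f_tensor by (simp add: e_def)
  have Fe: "F e t = s (m t * f t) (G z)" for t
    using e by (simp add: F_def weighted_composition_def e_def bounded_operatorsD[OF G])
  have norm_Fe: "sup_norm (F e) = 1"
  proof (rule sup_norm_eq_1I[of _ t\<^sub>1])
    show "norm (F e t) \<le> 1" for t
      using mult_le_one[OF m_le _ f_le, of t t] by (simp add: Fe Z.norm_scale Gz norm_mult)
  qed (simp_all add: Fe m1 f Gz F_maps e)
  have norm_e: "sup_norm e = 1"
    by (rule sup_norm_eq_1I[OF e, of t\<^sub>1]) (use f_le in \<open>auto simp: e_def Z.norm_scale z f\<close>)
  have op_F: "operator_norm X sup_norm sup_norm F = 1"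
  proof (rule antisym)
    show "operator_norm X sup_norm sup_norm F \<le> 1"
      using F_le by (intro operator_norm_least[OF nX]) fastforce
    show "1 \<le> operator_norm X sup_norm sup_norm F"
      using norm_operator_le[OF nX F_op e] by (simp add: norm_Fe norm_e)
  qed
  define V where "V = {delta_tensor X t \<zeta> | t \<zeta>. t \<in> W \<and> \<eta> \<le> norm (m t) \<and> \<zeta> \<in> VZ}"
  have V_dual: "V \<subseteq> dual sX X sup_norm"
    using VZ(1) \<Gamma>Z_dual by (auto simp: V_def intro!: delta_tensor_in_dual)
  have VI: "norm (\<phi> e - 1) \<le> \<epsilon>" if "\<phi> \<in> V" for \<phi>
  proof -
    obtain t \<zeta> where t: "\<phi> = delta_tensor X t \<zeta>" "\<eta> \<le> norm (m t)" "\<zeta> \<in> VZ"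
      using \<open>\<phi> \<in> V\<close> by (auto simp: V_def)
    have \<zeta>: "\<zeta> \<in> dual s UNIV norm" using t VZ \<Gamma>Z_dual by auto
    have "norm (\<phi> e - 1) = norm (f t * (\<zeta> z - 1) + (f t - 1))"
      unfolding t(1) delta_tensor_apply[OF e] by (simp add: e_def dualD[OF \<zeta>] algebra_simps)
    also have "\<dots> \<le> norm (f t) * norm (\<zeta> z - 1) + norm (1 - f t)"
      using norm_triangle_ineq[of "f t * (\<zeta> z - 1)" "f t - 1"] by (simp add: norm_mult norm_minus_commute)
    also have "\<dots> \<le> 1 * \<eta> + \<eta>"
      using f_le f_near[OF t(2)] near[OF t(3)] by (intro add_mono mult_mono) auto
    finally show ?thesis using \<eta> by simp
  qed
  have V: "dual_dist X sup_norm (adjoint_map F \<phi>) (aco ({0} \<union> V)) < \<epsilon>" if \<phi>\<Gamma>: "\<phi> \<in> ?\<Gamma>" for \<phi>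
  proof -
    obtain t \<zeta> where \<phi>: "\<phi> = delta_tensor X t \<zeta>" and \<zeta>: "\<zeta> \<in> \<Gamma>Z" using \<phi>\<Gamma> by auto
    have \<zeta>': "\<zeta> \<in> dual s UNIV norm" using \<zeta> \<Gamma>Z_dual by auto
    have \<phi>': "\<phi> \<in> dual sX X sup_norm" unfolding \<phi> by (rule delta_tensor_in_dual[OF \<zeta>'])
    have adj_\<phi>: "adjoint_map F \<phi> x = m t * \<zeta> (G (x t))" if "x \<in> X" for x
      unfolding \<phi> adj[OF \<zeta>'] delta_tensor_apply[OF that]
      by (simp add: pointwise_scale_def adjoint_map_def)
    show ?thesis
    proof (cases "\<eta> \<le> norm (m t)")
      case True
      have "t \<in> W" using f(3)[of t] m_le_f[of t] True by force
      \<comment> \<open>An approximant within \<open>\<eta>\<close> in the dual of \<open>Z\<close>, placed over \<open>t\<close> and multiplied by \<open>m t\<close>,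
        stays in the absolutely convex hull because \<open>|m t| \<le> 1\<close>.\<close>
      obtain \<psi> where \<psi>: "\<psi> \<in> aco ({0} \<union> VZ)" "dual_norm UNIV norm (adjoint_map G \<zeta> - \<psi>) < \<eta>"
      proof -
        have "aco ({0} \<union> VZ) \<noteq> {}" unfolding aco_def using hull_subset[of "{0} \<union> VZ"] by fast
        then show thesis
          using cInf_lessD[of "(\<lambda>\<psi>. dual_norm UNIV norm (adjoint_map G \<zeta> - \<psi>)) ` aco ({0} \<union> VZ)" \<eta>]
            dist[OF \<zeta>] that by (auto simp: dual_dist_def)
      qed
      have diff: "adjoint_map G \<zeta> - \<psi> \<in> dual s UNIV norm"
        using VZ(1) \<Gamma>Z_dual
        by (intro dual_diff[OF nZ adj_dual[OF \<zeta>] aco_in_dual[OF nZ \<psi>(1)]]) auto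
      have "delta_tensor X t \<psi> \<in> aco ({0} \<union> V)"
        using \<psi>(1) \<open>t \<in> W\<close> True by (intro delta_tensor_aco[of \<psi> VZ]) (auto simp: V_def)
      then have "pointwise_scale (*) (m t) (delta_tensor X t \<psi>) + pointwise_scale (*) 0 (delta_tensor X t \<psi>)
          \<in> aco ({0} \<union> V)"
        using absolutely_convex_aco[of "{0} \<union> V"] m_le[of t] unfolding absolutely_convex_def by force
      then have "pointwise_scale (*) (m t) (delta_tensor X t \<psi>) \<in> aco ({0} \<union> V)"
        by (simp add: pointwise_scale_def plus_fun_def)
      then have "dual_dist X sup_norm (adjoint_map F \<phi>) (aco ({0} \<union> V))
          \<le> dual_norm X sup_norm (adjoint_map F \<phi> - pointwise_scale (*) (m t) (delta_tensor X t \<psi>))"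
        by (rule dual_dist_le[OF nX adjoint_in_dual[OF nX \<phi>' F_op] V_dual])
      also have "\<dots> \<le> dual_norm UNIV norm (adjoint_map G \<zeta> - \<psi>)"
      proof (rule operator_norm_least[OF nX])
        fix x assume x: "x \<in> X" "sup_norm x \<le> 1"
        have "norm ((adjoint_map F \<phi> - pointwise_scale (*) (m t) (delta_tensor X t \<psi>)) x)
            = norm (m t) * norm ((adjoint_map G \<zeta> - \<psi>) (x t))"
          by (simp add: adj_\<phi> x delta_tensor_apply pointwise_scale_def)
            (simp add: adjoint_map_def flip: norm_mult right_diff_distrib)
        also have "\<dots> \<le> 1 * (dual_norm UNIV norm (adjoint_map G \<zeta> - \<psi>) * norm (x t))"
          by (intro mult_mono m_le norm_dual_le[OF nZ diff]) auto
        also have "\<dots> \<le> 1 * (dual_norm UNIV norm (adjoint_map G \<zeta> - \<psi>) * 1)"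
          using norm_le_sup_norm[OF x(1), of t] x(2)
          by (intro mult_left_mono dual_norm_nonneg[OF nZ diff]) auto
        finally show "norm ((adjoint_map F \<phi> - pointwise_scale (*) (m t) (delta_tensor X t \<psi>)) x)
            \<le> dual_norm UNIV norm (adjoint_map G \<zeta> - \<psi>)" by simp
      qed
      finally show ?thesis using \<psi>(2) \<eta> by linarith
    next
      case False
      have "0 \<in> aco ({0} \<union> V)" unfolding aco_def by (intro hull_inc) auto
      then have "dual_dist X sup_norm (adjoint_map F \<phi>) (aco ({0} \<union> V))
          \<le> dual_norm X sup_norm (adjoint_map F \<phi> - 0)"
        by (rule dual_dist_le[OF nX adjoint_in_dual[OF nX \<phi>' F_op] V_dual])
      also have "\<dots> \<le> norm (m t)"
      proof (rule operator_norm_least[OF nX])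
        fix x assume x: "x \<in> X" "sup_norm x \<le> 1"
        have "norm (\<zeta> (G (x t))) \<le> norm (G (x t))"
          using \<zeta> \<Gamma>Z by (intro norm_dual_ball_le[OF nZ]) auto
        also have "\<dots> \<le> norm (x t)" using norm_operator_le[OF nZ G, of "x t"] Gz(2) by simp
        also have "\<dots> \<le> 1" using norm_le_sup_norm[OF x(1), of t] x(2) by simp
        finally show "norm ((adjoint_map F \<phi> - 0) x) \<le> norm (m t)"
          using mult_left_mono[of _ 1 "norm (m t)"] by (simp add: adj_\<phi> x norm_mult)
      qed
      finally show ?thesis using False \<eta> by linarith
    qed
  qed
  have V1: "delta_tensor X t \<zeta> \<in> ack_V1 X sup_norm ?\<Gamma> \<epsilon> F"
    if "\<zeta> \<in> ack_V1 UNIV norm \<Gamma>Z \<eta> G" for t \<zeta>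
  proof -
    let ?\<phi> = "delta_tensor X t \<zeta>"
    let ?a = "dual_norm UNIV norm (adjoint_map G \<zeta>)"
    let ?b = "dual_norm UNIV norm (\<zeta> - adjoint_map G \<zeta>)"
    have \<zeta>: "\<zeta> \<in> \<Gamma>Z" and ab: "?a + (1 - \<eta>) * ?b \<le> 1" using that by (auto simp: ack_V1_def)
    have \<zeta>': "\<zeta> \<in> dual s UNIV norm" using \<zeta> \<Gamma>Z_dual by auto
    have diff: "\<zeta> - adjoint_map G \<zeta> \<in> dual s UNIV norm"
      by (rule dual_diff[OF nZ \<zeta>' adj_dual[OF \<zeta>]])
    have b0: "0 \<le> ?b" by (rule dual_norm_nonneg[OF nZ diff])
    have a: "dual_norm X sup_norm (adjoint_map F ?\<phi>) \<le> norm (m t) * ?a"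
    proof (rule operator_norm_least[OF nX])
      fix x assume x: "x \<in> X" "sup_norm x \<le> 1"
      have "norm (adjoint_map G \<zeta> (x t)) \<le> ?a * norm (x t)"
        by (rule norm_dual_le[OF nZ adj_dual[OF \<zeta>]]) simp
      also have "\<dots> \<le> ?a * 1"
        using norm_le_sup_norm[OF x(1), of t] x(2)
        by (intro mult_left_mono dual_norm_nonneg[OF nZ adj_dual[OF \<zeta>]]) auto
      finally show "norm (adjoint_map F ?\<phi> x) \<le> norm (m t) * ?a"
        by (simp add: adj[OF \<zeta>'] delta_tensor_apply x pointwise_scale_def norm_mult mult_left_mono)
    qed
    have b: "dual_norm X sup_norm (?\<phi> - adjoint_map F ?\<phi>) \<le> norm (m t) * ?b + norm (1 - m t)"
    proof (rule operator_norm_least[OF nX])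
      fix x assume x: "x \<in> X" "sup_norm x \<le> 1"
      have xt: "norm (x t) \<le> 1" using norm_le_sup_norm[OF x(1), of t] x(2) by simp
      have "norm ((\<zeta> - adjoint_map G \<zeta>) (x t)) \<le> ?b * norm (x t)"
        by (rule norm_dual_le[OF nZ diff]) simp
      also have "\<dots> \<le> ?b * 1" using xt b0 by (intro mult_left_mono)
      finally have 1: "norm ((\<zeta> - adjoint_map G \<zeta>) (x t)) \<le> ?b" by simp
      have "norm (\<zeta> (x t)) \<le> norm (x t)" using \<zeta> \<Gamma>Z by (intro norm_dual_ball_le[OF nZ]) auto
      then have 2: "norm (\<zeta> (x t)) \<le> 1" using xt by simp
      have "norm ((?\<phi> - adjoint_map F ?\<phi>) x)
          = norm (m t * (\<zeta> - adjoint_map G \<zeta>) (x t) + (1 - m t) * \<zeta> (x t))"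
        by (simp add: adj[OF \<zeta>'] delta_tensor_apply x pointwise_scale_def algebra_simps)
      also have "\<dots> \<le> norm (m t) * norm ((\<zeta> - adjoint_map G \<zeta>) (x t)) + norm (1 - m t) * norm (\<zeta> (x t))"
        by (metis norm_mult norm_triangle_ineq)
      also have "\<dots> \<le> norm (m t) * ?b + norm (1 - m t) * 1"
        using 1 2 by (intro add_mono mult_left_mono) auto
      finally show "norm ((?\<phi> - adjoint_map F ?\<phi>) x) \<le> norm (m t) * ?b + norm (1 - m t)" by simp
    qed
    have \<phi>': "?\<phi> \<in> dual sX X sup_norm" by (rule delta_tensor_in_dual[OF \<zeta>'])
    have "(1 - \<epsilon>) * dual_norm X sup_norm (?\<phi> - adjoint_map F ?\<phi>)
        \<le> (1 - \<eta>) * dual_norm X sup_norm (?\<phi> - adjoint_map F ?\<phi>)"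
      using \<eta> dual_norm_nonneg[OF nX dual_diff[OF nX \<phi>' adjoint_in_dual[OF nX \<phi>' F_op]]]
      by (intro mult_right_mono) auto
    also have "\<dots> \<le> (1 - \<eta>) * (norm (m t) * ?b + norm (1 - m t))"
      using b \<eta> by (intro mult_left_mono) auto
    finally have "dual_norm X sup_norm (adjoint_map F ?\<phi>)
          + (1 - \<epsilon>) * dual_norm X sup_norm (?\<phi> - adjoint_map F ?\<phi>)
        \<le> norm (m t) * ?a + (1 - \<eta>) * (norm (m t) * ?b + norm (1 - m t))"
      using a by simp
    also have "\<dots> = norm (m t) * (?a + (1 - \<eta>) * ?b) + (1 - \<eta>) * norm (1 - m t)"
      by (simp add: algebra_simps)
    also have "\<dots> \<le> norm (m t) * 1 + (1 - \<eta>) * norm (1 - m t)"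
      by (intro add_right_mono mult_left_mono ab) auto
    also have "\<dots> \<le> 1" using m_St[of t] by simp
    finally show ?thesis using \<zeta> by (auto simp: ack_V1_def)
  qed
  have \<zeta>\<^sub>1: "\<zeta>\<^sub>1 \<in> dual s UNIV norm" using VZ \<Gamma>Z_dual by auto
  show thesis
  proof (rule that[of V "delta_tensor X t\<^sub>1 \<zeta>\<^sub>1" e F])
    show "V \<subseteq> {delta_tensor X t \<zeta> | t \<zeta>. t \<in> W \<and> \<zeta> \<in> VZ}" by (auto simp: V_def)
    show "delta_tensor X t\<^sub>1 \<zeta>\<^sub>1 \<in> V"
      unfolding V_def using f(2) \<eta> VZ(2) m1 by (intro CollectI exI[of _ t\<^sub>1] exI[of _ \<zeta>\<^sub>1]) simp
    show "ack_base X sup_norm ?\<Gamma> \<epsilon> V (delta_tensor X t\<^sub>1 \<zeta>\<^sub>1) e F"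
      unfolding ack_base_def
    proof (intro conjI ballI)
      show "delta_tensor X t\<^sub>1 \<zeta>\<^sub>1 (F e) = 1"
        by (simp add: delta_tensor_apply F_maps e Fe m1 f Gz)
      show "adjoint_map F (delta_tensor X t\<^sub>1 \<zeta>\<^sub>1) = delta_tensor X t\<^sub>1 \<zeta>\<^sub>1"
        by (simp add: adj[OF \<zeta>\<^sub>1] m1 Gz pointwise_scale_def)
    qed (fact norm_Fe op_F V VI)+
    show "norm (delta_tensor X t \<zeta> (F e)) \<le> norm (\<zeta> (G z))" if "\<zeta> \<in> \<Gamma>Z" for t \<zeta>
    proof -
      have "\<zeta> \<in> dual s UNIV norm" using that \<Gamma>Z_dual by auto
      then show ?thesis
        using mult_right_mono[OF mult_le_one[OF m_le norm_ge_zero f_le, of t t], of "norm (\<zeta> (G z))"]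
        by (simp add: delta_tensor_apply F_maps e Fe dualD norm_mult)
    qed
  qed (fact e norm_e F_op V1)+
qed

end

section \<open>Basic weak-star neighbourhoods\<close>

text \<open>The weak-star topology is generated from a subbase, so its open sets are reached by induction on
  generation. Lists collect the finitely many constraints, because an intersection then becomes
  concatenation.\<close>

lemma weak_star_nhd_basis:
  assumes "openin (weak_star s X N) T" "\<phi> \<in> T"
  obtains n :: nat and x and G where "\<forall>k<n. x k \<in> X \<and> open (G k) \<and> \<phi> (x k) \<in> G k"
    "\<And>\<psi>. \<psi> \<in> dual s X N \<Longrightarrow> (\<forall>k<n. \<psi> (x k) \<in> G k) \<Longrightarrow> \<psi> \<in> T"
proof -
  define basis where "basis = insert (dual s X N)
    {{\<psi> \<in> dual s X N. p \<psi> \<in> G} | p G. p \<in> (\<lambda>x \<phi>. \<phi> x) ` X \<and> open G}"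
  have "generate_topology_on basis T"
    using assms(1) by (simp add: weak_star_def weakest_topology_def openin_topology_generated_by_iff basis_def)
  then have "\<phi> \<in> T \<longrightarrow> (\<exists>L. (\<forall>(x, G)\<in>set L. x \<in> X \<and> open G \<and> \<phi> x \<in> G) \<and>
      (\<forall>\<psi>\<in>dual s X N. (\<forall>(x, G)\<in>set L. \<psi> x \<in> G) \<longrightarrow> \<psi> \<in> T))"
  proof induction
    case Empty
    then show ?case by simp
  next
    case (Int a b)
    show ?case
    proof
      assume "\<phi> \<in> a \<inter> b"
      with Int obtain L1 L2 where
        "\<forall>(x, G)\<in>set L1. x \<in> X \<and> open G \<and> \<phi> x \<in> G" "\<forall>(x, G)\<in>set L2. x \<in> X \<and> open G \<and> \<phi> x \<in> G"
        "\<forall>\<psi>\<in>dual s X N. (\<forall>(x, G)\<in>set L1. \<psi> x \<in> G) \<longrightarrow> \<psi> \<in> a"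
        "\<forall>\<psi>\<in>dual s X N. (\<forall>(x, G)\<in>set L2. \<psi> x \<in> G) \<longrightarrow> \<psi> \<in> b"
        by blast
      then show "\<exists>L. (\<forall>(x, G)\<in>set L. x \<in> X \<and> open G \<and> \<phi> x \<in> G) \<and>
          (\<forall>\<psi>\<in>dual s X N. (\<forall>(x, G)\<in>set L. \<psi> x \<in> G) \<longrightarrow> \<psi> \<in> a \<inter> b)"
        by (intro exI[of _ "L1 @ L2"]) (simp add: ball_Un)
    qed
  next
    case (UN K)
    show ?case
    proof
      assume "\<phi> \<in> \<Union>K"
      then obtain k where k: "k \<in> K" "\<phi> \<in> k" by auto
      with UN(2)[OF k(1)] show "\<exists>L. (\<forall>(x, G)\<in>set L. x \<in> X \<and> open G \<and> \<phi> x \<in> G) \<and>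
          (\<forall>\<psi>\<in>dual s X N. (\<forall>(x, G)\<in>set L. \<psi> x \<in> G) \<longrightarrow> \<psi> \<in> \<Union>K)"
        by blast
    qed
  next
    case (Basis b)
    show ?case
    proof
      assume \<phi>: "\<phi> \<in> b"
      consider "b = dual s X N" | x G where "x \<in> X" "open G" "b = {\<psi> \<in> dual s X N. \<psi> x \<in> G}"
        using Basis by (auto simp: basis_def)
      then show "\<exists>L. (\<forall>(x, G)\<in>set L. x \<in> X \<and> open G \<and> \<phi> x \<in> G) \<and>
          (\<forall>\<psi>\<in>dual s X N. (\<forall>(x, G)\<in>set L. \<psi> x \<in> G) \<longrightarrow> \<psi> \<in> b)"
      proof cases
        case 1
        then show ?thesis by (intro exI[of _ "[]"]) auto
      next
        case (2 x G)
        then show ?thesis using \<phi> by (intro exI[of _ "[(x, G)]"]) auto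
      qed
    qed
  qed
  then obtain L where L: "\<forall>(x, G)\<in>set L. x \<in> X \<and> open G \<and> \<phi> x \<in> G"
      "\<forall>\<psi>\<in>dual s X N. (\<forall>(x, G)\<in>set L. \<psi> x \<in> G) \<longrightarrow> \<psi> \<in> T"
    using assms(2) by blast
  show thesis
  proof (rule that[of "length L" "\<lambda>k. fst (L ! k)" "\<lambda>k. snd (L ! k)"])
    show "\<forall>k<length L. fst (L ! k) \<in> X \<and> open (snd (L ! k)) \<and> \<phi> (fst (L ! k)) \<in> snd (L ! k)"
      using L(1) by (auto simp: case_prod_beta)
    show "\<psi> \<in> T" if "\<psi> \<in> dual s X N" "\<forall>k<length L. \<psi> (fst (L ! k)) \<in> snd (L ! k)" for \<psi>
      using that by (intro L(2)[rule_format]) (auto simp: in_set_conv_nth)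
  qed
qed

lemma topspace_weak_star: "topspace (weak_star s X N) = dual s X N"
  by (auto simp: weak_star_def weakest_topology_def)

text \<open>Quasi-continuity replaces joint continuity of \<open>(t, \<zeta>) \<mapsto> \<zeta> (x t)\<close>, which may fail: the open
  set of good pairs it produces need not contain the given pair \<open>(t\<^sub>0, \<zeta>\<^sub>0)\<close>, but a box around any of
  its points serves the purpose, since the conditions of an ACK structure ask only for some
  non-empty \<open>V \<subseteq> U\<close>.\<close>

lemma (in bounded_function_space) delta_tensor_box:
  fixes \<Gamma>Z :: "('z \<Rightarrow> 'k) set" and \<T> :: "'t topology"
  assumes \<Gamma>Z: "\<Gamma>Z \<subseteq> dual s UNIV norm" and \<T>: "topspace \<T> = UNIV"
    and qc: "\<And>(n::nat) x. (\<forall>k<n. x k \<in> X) \<Longrightarrow>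
      quasi_continuous (prod_topology \<T> (subtopology (weak_star s UNIV norm) \<Gamma>Z))
        (product_topology (\<lambda>_. euclidean) {..<n}) (\<lambda>(t, \<zeta>). \<lambda>k\<in>{..<n}. \<zeta> (x k t))"
    and U: "openin (subtopology (weak_star sX X sup_norm) {delta_tensor X t \<zeta> | t \<zeta>. \<zeta> \<in> \<Gamma>Z}) U" "U \<noteq> {}"
  obtains W UZ where "openin \<T> W" "W \<noteq> {}"
    "openin (subtopology (weak_star s UNIV norm) \<Gamma>Z) UZ" "UZ \<noteq> {}"
    "\<And>t \<zeta>. t \<in> W \<Longrightarrow> \<zeta> \<in> UZ \<Longrightarrow> delta_tensor X t \<zeta> \<in> U"
proof -
  let ?\<Gamma> = "{delta_tensor X t \<zeta> | t \<zeta>. \<zeta> \<in> \<Gamma>Z}"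
  let ?P = "prod_topology \<T> (subtopology (weak_star s UNIV norm) \<Gamma>Z)"
  obtain T where T: "openin (weak_star sX X sup_norm) T" "U = T \<inter> ?\<Gamma>"
    using U(1) by (auto simp: openin_subtopology)
  obtain t\<^sub>0 \<zeta>\<^sub>0 where 0: "\<zeta>\<^sub>0 \<in> \<Gamma>Z" "delta_tensor X t\<^sub>0 \<zeta>\<^sub>0 \<in> T" using U(2) T(2) by auto
  obtain n :: nat and x G where x: "\<forall>k<n. x k \<in> X \<and> open (G k) \<and> delta_tensor X t\<^sub>0 \<zeta>\<^sub>0 (x k) \<in> G k"
    and in_T: "\<And>\<psi>. \<psi> \<in> dual sX X sup_norm \<Longrightarrow> (\<forall>k<n. \<psi> (x k) \<in> G k) \<Longrightarrow> \<psi> \<in> T"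
    using weak_star_nhd_basis[OF T(1) 0(2)] by blast
  have top: "topspace ?P = UNIV \<times> \<Gamma>Z" using \<Gamma>Z by (auto simp: topspace_weak_star \<T>)
  have "quasi_continuous ?P (product_topology (\<lambda>_. euclidean) {..<n}) (\<lambda>(t, \<zeta>). \<lambda>k\<in>{..<n}. \<zeta> (x k t))"
    using x by (intro qc) auto
  moreover have "openin (product_topology (\<lambda>_. euclidean) {..<n}) (Pi\<^sub>E {..<n} G)"
    using x by (auto simp: openin_PiE_gen)
  moreover have "(\<lambda>(t, \<zeta>). \<lambda>k\<in>{..<n}. \<zeta> (x k t)) (t\<^sub>0, \<zeta>\<^sub>0) \<in> Pi\<^sub>E {..<n} G"
    using x by (auto simp: delta_tensor_def)
  moreover have "(t\<^sub>0, \<zeta>\<^sub>0) \<in> topspace ?P" using 0 top by auto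
  ultimately obtain D where D: "openin ?P D" "D \<noteq> {}"
    "(\<lambda>(t, \<zeta>). \<lambda>k\<in>{..<n}. \<zeta> (x k t)) ` D \<subseteq> Pi\<^sub>E {..<n} G"
    unfolding quasi_continuous_def by (meson openin_topspace)
  from D(2) obtain t \<zeta> where "(t, \<zeta>) \<in> D" by auto
  then obtain W UZ where W: "openin \<T> W" "openin (subtopology (weak_star s UNIV norm) \<Gamma>Z) UZ"
    "t \<in> W" "\<zeta> \<in> UZ" "W \<times> UZ \<subseteq> D"
    using D(1) unfolding openin_prod_topology_alt by meson
  show thesis
  proof (rule that[of W UZ])
    fix t \<zeta> assume t: "t \<in> W" "\<zeta> \<in> UZ"
    then have \<zeta>: "\<zeta> \<in> \<Gamma>Z" using openin_subset[OF W(2)] by auto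
    have "(\<lambda>k\<in>{..<n}. \<zeta> (x k t)) \<in> Pi\<^sub>E {..<n} G" using D(3) W(5) t by fast
    then have "\<forall>k<n. delta_tensor X t \<zeta> (x k) \<in> G k"
      using x by (auto simp: delta_tensor_def PiE_iff)
    then have "delta_tensor X t \<zeta> \<in> T"
      using in_T[OF delta_tensor_in_dual] \<zeta> \<Gamma>Z by blast
    then show "delta_tensor X t \<zeta> \<in> U" using T(2) \<zeta> by auto
  qed (use W in auto)
qed

theorem theorem4p16:
  fixes A :: "('t::topological_space \<Rightarrow> 'k::real_or_complex) set"
    and s :: "'k \<Rightarrow> 'z::banach \<Rightarrow> 'z"
    and Ops :: "('z \<Rightarrow> 'z) set"
    and \<rho> :: real
    and \<Gamma>Z :: "('z \<Rightarrow> 'k) set"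
    and \<tau> :: "'z topology"
    and X :: "('t \<Rightarrow> 'z) set"
  defines "sX \<equiv> pointwise_scale s"
    and "\<Gamma> \<equiv> {delta_tensor X t \<zeta> | t \<zeta>. \<zeta> \<in> \<Gamma>Z}"
  assumes A: "ACK_subalgebra A"
    and Z: "banach_space_on s UNIV norm"
    and Ops: "Ops \<subseteq> bounded_operators s UNIV norm" "Ops \<noteq> {}"
    and \<rho>: "0 \<le> \<rho>" "\<rho> < 1"
    and \<tau>: "acceptable_topology s \<Gamma>Z \<tau>"
    and X: "X \<subseteq> Cb \<tau>" "banach_space_on sX X sup_norm"
    and i: "\<And>x f. x \<in> X \<Longrightarrow> f \<in> A \<Longrightarrow> (\<lambda>t. s (f t) (x t)) \<in> X"
    and ii: "\<And>f z. f \<in> A \<Longrightarrow> (\<lambda>t. s (f t) z) \<in> X"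
    and iii: "\<And>x F. x \<in> X \<Longrightarrow> F \<in> Ops \<Longrightarrow> F \<circ> x \<in> X"
    and iv: "\<And>(n::nat) x. (\<forall>k<n. x k \<in> X) \<Longrightarrow>
      quasi_continuous
        (prod_topology euclidean (subtopology (weak_star s UNIV norm) \<Gamma>Z))
        (product_topology (\<lambda>_. euclidean) {..<n})
        (\<lambda>(t, \<zeta>). \<lambda>k\<in>{..<n}. \<zeta> (x k t))"
  shows "(ack_rho s UNIV norm Ops \<rho> \<Gamma>Z \<longrightarrow>
            ack_rho sX X sup_norm (bounded_operators sX X sup_norm) \<rho> \<Gamma>)
       \<and> (ack_simple s UNIV norm Ops \<Gamma>Z \<longrightarrow>
            ack_simple sX X sup_norm (bounded_operators sX X sup_norm) \<Gamma>)"
proof -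
  have nZ: "normed_space_on s UNIV norm" and nX: "normed_space_on sX X sup_norm"
    using Z X(2) by (auto simp: banach_space_on_def)
  interpret bounded_function_space s X
    using nZ nX X(1) by (auto simp: bounded_function_space_def bounded_function_space_axioms_def
        sX_def Cb_def)
  have \<Gamma>_ball: "\<Gamma> \<subseteq> dual_ball sX X sup_norm" if "\<Gamma>Z \<subseteq> dual_ball s UNIV norm"
    using that delta_tensor_in_dual_ball unfolding \<Gamma>_def sX_def by blast
  \<comment> \<open>Both ACK notions require the same conditions up to (IV); \<open>Q\<close> stands for (IV) in \<open>Z\<close>, and
    it is turned into (IV) in \<open>X\<close> separately for each notion below.\<close>
  have step: "\<exists>V \<phi>\<^sub>1 e F. V \<noteq> {} \<and> V \<subseteq> U \<and> \<phi>\<^sub>1 \<in> V \<and> e \<in> X \<and> sup_norm e = 1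
      \<and> F \<in> bounded_operators sX X sup_norm \<and> ack_base X sup_norm \<Gamma> \<epsilon> V \<phi>\<^sub>1 e F \<and>
      (\<exists>\<eta> z G. Q \<eta> z G \<and>
        (\<forall>t. \<forall>\<zeta>\<in>ack_V1 UNIV norm \<Gamma>Z \<eta> G. delta_tensor X t \<zeta> \<in> ack_V1 X sup_norm \<Gamma> \<epsilon> F) \<and>
        (\<forall>t. \<forall>\<zeta>\<in>\<Gamma>Z. norm (delta_tensor X t \<zeta> (F e)) \<le> norm (\<zeta> (G z))))"
    if \<Gamma>Z: "\<Gamma>Z \<subseteq> dual_ball s UNIV norm" and "0 < \<epsilon>"
      and U: "openin (subtopology (weak_star sX X sup_norm) \<Gamma>) U" "U \<noteq> {}"
      and Z_step: "\<forall>\<eta>>0. \<forall>UZ. openin (subtopology (weak_star s UNIV norm) \<Gamma>Z) UZ \<and> UZ \<noteq> {} \<longrightarrow>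
        (\<exists>V \<zeta>\<^sub>1 z G. V \<noteq> {} \<and> V \<subseteq> UZ \<and> \<zeta>\<^sub>1 \<in> V \<and> z \<in> UNIV \<and> norm z = 1 \<and> G \<in> Ops \<and>
           ack_base UNIV norm \<Gamma>Z \<eta> V \<zeta>\<^sub>1 z G \<and> Q \<eta> z G)"
    for \<epsilon> U and Q :: "real \<Rightarrow> 'z \<Rightarrow> ('z \<Rightarrow> 'z) \<Rightarrow> bool"
  proof -
    define \<eta> where "\<eta> = min \<epsilon> 1 / 2"
    have \<eta>: "0 < \<eta>" "\<eta> \<le> 1 / 2" "2 * \<eta> \<le> \<epsilon>" using \<open>0 < \<epsilon>\<close> by (auto simp: \<eta>_def)
    have \<Gamma>Z': "\<Gamma>Z \<subseteq> dual s UNIV norm" using \<Gamma>Z by (auto simp: dual_ball_def)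
    obtain W UZ where W: "openin euclidean W" "W \<noteq> {}"
      and UZ: "openin (subtopology (weak_star s UNIV norm) \<Gamma>Z) UZ" "UZ \<noteq> {}"
      and in_U: "\<And>t \<zeta>. t \<in> W \<Longrightarrow> \<zeta> \<in> UZ \<Longrightarrow> delta_tensor X t \<zeta> \<in> U"
      by (rule delta_tensor_box[OF \<Gamma>Z' topspace_euclidean iv U[unfolded sX_def \<Gamma>_def]], assumption, rule that)
    obtain V \<zeta>\<^sub>1 z G where V: "V \<subseteq> UZ" "\<zeta>\<^sub>1 \<in> V" "norm z = 1" and G: "G \<in> Ops"
      and base: "ack_base UNIV norm \<Gamma>Z \<eta> V \<zeta>\<^sub>1 z G" and Q: "Q \<eta> z G"
      using Z_step[rule_format, OF \<eta>(1) conjI[OF UZ]] by (elim exE conjE) (rule that)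
    have "open W \<and> W \<noteq> {} \<and> 0 < \<eta> \<and> \<eta> < 1" using W \<eta> by simp
    from A[unfolded ACK_subalgebra_def, THEN conjunct2, rule_format, OF this]
    obtain f t\<^sub>1 where f: "f \<in> A" "t\<^sub>1 \<in> W" "f t\<^sub>1 = 1" "range f \<subseteq> St \<eta>"
      and f_small: "\<forall>t. t \<notin> W \<longrightarrow> norm (f t) < \<eta>"
      by (elim bexE conjE) (rule that)
    have "V \<subseteq> \<Gamma>Z" using V(1) openin_subset[OF UZ(1)] by auto
    have G_op: "G \<in> bounded_operators s UNIV norm" using G Ops(1) by blast
    obtain V' \<phi>\<^sub>1 e F where V': "V' \<subseteq> {delta_tensor X t \<zeta> | t \<zeta>. t \<in> W \<and> \<zeta> \<in> V}" "\<phi>\<^sub>1 \<in> V'"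
      and e: "e \<in> X" "sup_norm e = 1" and F: "F \<in> bounded_operators sX X sup_norm"
      and base': "ack_base X sup_norm \<Gamma> \<epsilon> V' \<phi>\<^sub>1 e F"
      and V1: "\<And>t \<zeta>. \<zeta> \<in> ack_V1 UNIV norm \<Gamma>Z \<eta> G \<Longrightarrow>
        delta_tensor X t \<zeta> \<in> ack_V1 X sup_norm \<Gamma> \<epsilon> F"
      and le: "\<And>t \<zeta>. \<zeta> \<in> \<Gamma>Z \<Longrightarrow> norm (delta_tensor X t \<zeta> (F e)) \<le> norm (\<zeta> (G z))"
      by (rule ack_step_lift[OF \<eta> \<Gamma>Z \<open>V \<subseteq> \<Gamma>Z\<close> V(2) G_op V(3) base f(3,2) f_small[rule_format] f(4)
            i[OF _ f(1)] iii[OF _ G] ii[OF f(1)],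
            folded \<Gamma>_def sX_def]) (assumption | rule that)+
    have "V' \<subseteq> U" using V'(1) in_U V(1) by blast
    show ?thesis
      by (rule exI[of _ V'], rule exI[of _ \<phi>\<^sub>1], rule exI[of _ e], rule exI[of _ F],
          intro conjI, use V'(2) in blast,
          (fact | rule exI[of _ \<eta>], rule exI[of _ z], rule exI[of _ G], use Q V1 le in simp)+)
  qed
  show ?thesis
  proof (intro conjI impI)
    assume "ack_rho s UNIV norm Ops \<rho> \<Gamma>Z"
    then have ball: "\<Gamma>Z \<subseteq> dual_ball s UNIV norm" and norming: "one_norming UNIV norm \<Gamma>Z"
      and Z_step: "\<forall>\<eta>>0. \<forall>UZ. openin (subtopology (weak_star s UNIV norm) \<Gamma>Z) UZ \<and> UZ \<noteq> {} \<longrightarrow>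
        (\<exists>V \<zeta>\<^sub>1 z G. V \<noteq> {} \<and> V \<subseteq> UZ \<and> \<zeta>\<^sub>1 \<in> V \<and> z \<in> UNIV \<and> norm z = 1 \<and> G \<in> Ops \<and>
           ack_base UNIV norm \<Gamma>Z \<eta> V \<zeta>\<^sub>1 z G \<and>
           (\<forall>\<phi>\<in>\<Gamma>Z - ack_V1 UNIV norm \<Gamma>Z \<eta> G. norm (\<phi> (G z)) \<le> \<rho>))"
      unfolding ack_rho_def by simp_all
    show "ack_rho sX X sup_norm (bounded_operators sX X sup_norm) \<rho> \<Gamma>"
      unfolding ack_rho_def
    proof (intro conjI allI impI)
      fix \<epsilon> :: real and U assume "0 < \<epsilon>" "openin (subtopology (weak_star sX X sup_norm) \<Gamma>) U \<and> U \<noteq> {}"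
      then have U: "openin (subtopology (weak_star sX X sup_norm) \<Gamma>) U" "U \<noteq> {}" by auto
      obtain V \<phi>\<^sub>1 e F \<eta> z G where *: "V \<noteq> {}" "V \<subseteq> U" "\<phi>\<^sub>1 \<in> V" "e \<in> X" "sup_norm e = 1"
        "F \<in> bounded_operators sX X sup_norm" "ack_base X sup_norm \<Gamma> \<epsilon> V \<phi>\<^sub>1 e F"
        and \<rho>_Z: "\<forall>\<phi>\<in>\<Gamma>Z - ack_V1 UNIV norm \<Gamma>Z \<eta> G. norm (\<phi> (G z)) \<le> \<rho>"
        and V1: "\<forall>t. \<forall>\<zeta>\<in>ack_V1 UNIV norm \<Gamma>Z \<eta> G. delta_tensor X t \<zeta> \<in> ack_V1 X sup_norm \<Gamma> \<epsilon> F"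
        and le: "\<forall>t. \<forall>\<zeta>\<in>\<Gamma>Z. norm (delta_tensor X t \<zeta> (F e)) \<le> norm (\<zeta> (G z))"
        using step[OF ball \<open>0 < \<epsilon>\<close> U Z_step] by (elim exE conjE) (rule that)
      have "norm (\<phi> (F e)) \<le> \<rho>" if \<phi>: "\<phi> \<in> \<Gamma> - ack_V1 X sup_norm \<Gamma> \<epsilon> F" for \<phi>
      proof -
        obtain t \<zeta> where \<zeta>: "\<phi> = delta_tensor X t \<zeta>" "\<zeta> \<in> \<Gamma>Z" using \<phi> by (auto simp: \<Gamma>_def)
        then have "norm (\<zeta> (G z)) \<le> \<rho>" using \<phi> V1 \<rho>_Z by blast
        then show ?thesis using le \<zeta> order_trans by blast
      qed
      with * show "\<exists>V \<phi>\<^sub>1 e F. V \<noteq> {} \<and> V \<subseteq> U \<and> \<phi>\<^sub>1 \<in> V \<and> e \<in> X \<and> sup_norm e = 1 \<and>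
          F \<in> bounded_operators sX X sup_norm \<and> ack_base X sup_norm \<Gamma> \<epsilon> V \<phi>\<^sub>1 e F \<and>
          (\<forall>\<phi>\<in>\<Gamma> - ack_V1 X sup_norm \<Gamma> \<epsilon> F. norm (\<phi> (F e)) \<le> \<rho>)"
        by (intro exI[of _ V] exI[of _ \<phi>\<^sub>1] exI[of _ e] exI[of _ F]) simp
    qed (use \<Gamma>_ball[OF ball] one_norming_delta_tensor[OF ball norming] in \<open>auto simp: \<Gamma>_def\<close>)
  next
    assume "ack_simple s UNIV norm Ops \<Gamma>Z"
    then have ball: "\<Gamma>Z \<subseteq> dual_ball s UNIV norm" and norming: "one_norming UNIV norm \<Gamma>Z"
      and Z_step: "\<forall>\<eta>>0. \<forall>UZ. openin (subtopology (weak_star s UNIV norm) \<Gamma>Z) UZ \<and> UZ \<noteq> {} \<longrightarrow>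
        (\<exists>V \<zeta>\<^sub>1 z G. V \<noteq> {} \<and> V \<subseteq> UZ \<and> \<zeta>\<^sub>1 \<in> V \<and> z \<in> UNIV \<and> norm z = 1 \<and> G \<in> Ops \<and>
           ack_base UNIV norm \<Gamma>Z \<eta> V \<zeta>\<^sub>1 z G \<and> ack_V1 UNIV norm \<Gamma>Z \<eta> G = \<Gamma>Z)"
      unfolding ack_simple_def by simp_all
    show "ack_simple sX X sup_norm (bounded_operators sX X sup_norm) \<Gamma>"
      unfolding ack_simple_def
    proof (intro conjI allI impI)
      fix \<epsilon> :: real and U assume "0 < \<epsilon>" "openin (subtopology (weak_star sX X sup_norm) \<Gamma>) U \<and> U \<noteq> {}"
      then have U: "openin (subtopology (weak_star sX X sup_norm) \<Gamma>) U" "U \<noteq> {}" by auto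
      obtain V \<phi>\<^sub>1 e F \<eta> z G where *: "V \<noteq> {}" "V \<subseteq> U" "\<phi>\<^sub>1 \<in> V" "e \<in> X" "sup_norm e = 1"
        "F \<in> bounded_operators sX X sup_norm" "ack_base X sup_norm \<Gamma> \<epsilon> V \<phi>\<^sub>1 e F"
        and eq: "ack_V1 UNIV norm \<Gamma>Z \<eta> G = \<Gamma>Z"
        and V1: "\<forall>t. \<forall>\<zeta>\<in>ack_V1 UNIV norm \<Gamma>Z \<eta> G. delta_tensor X t \<zeta> \<in> ack_V1 X sup_norm \<Gamma> \<epsilon> F"
        using step[OF ball \<open>0 < \<epsilon>\<close> U Z_step] by (elim exE conjE) (rule that)
      have "ack_V1 X sup_norm \<Gamma> \<epsilon> F = \<Gamma>"
      proof
        show "ack_V1 X sup_norm \<Gamma> \<epsilon> F \<subseteq> \<Gamma>" by (auto simp: ack_V1_def)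
        show "\<Gamma> \<subseteq> ack_V1 X sup_norm \<Gamma> \<epsilon> F"
        proof
          fix \<phi> assume "\<phi> \<in> \<Gamma>"
          then obtain t \<zeta> where "\<phi> = delta_tensor X t \<zeta>" "\<zeta> \<in> \<Gamma>Z" by (auto simp: \<Gamma>_def)
          with V1 eq show "\<phi> \<in> ack_V1 X sup_norm \<Gamma> \<epsilon> F" by blast
        qed
      qed
      with * show "\<exists>V \<phi>\<^sub>1 e F. V \<noteq> {} \<and> V \<subseteq> U \<and> \<phi>\<^sub>1 \<in> V \<and> e \<in> X \<and> sup_norm e = 1 \<and>
          F \<in> bounded_operators sX X sup_norm \<and> ack_base X sup_norm \<Gamma> \<epsilon> V \<phi>\<^sub>1 e F \<and>
          ack_V1 X sup_norm \<Gamma> \<epsilon> F = \<Gamma>"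
        by (intro exI[of _ V] exI[of _ \<phi>\<^sub>1] exI[of _ e] exI[of _ F]) simp
    qed (use \<Gamma>_ball[OF ball] one_norming_delta_tensor[OF ball norming] in \<open>auto simp: \<Gamma>_def\<close>)
  qed
qed

end
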